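(* Let $\mathbb{F}$ be a field and $V$ a non-zero finite-dimensional $\mathbb{F}$-vector space. Let $\langle-,-\rangle\colon\mathrm{St}(V)\otimes\mathrm{St}(V)\to\mathbb{Z}$ be the $\mathrm{GL}(V)$-invariant symmetric bilinear pairing on the Steinberg module obtained by restricting the pairing on simplicial chains of the Tits building for which the complete flags are orthonormal. Then the induced map on coinvariants (for the diagonal action) $$(\mathrm{St}(V)\otimes\mathrm{St}(V))_{\mathrm{GL}(V)}\longrightarrow\mathbb{Z}$$ is an isomorphism.
   Context: The Tits building $T(V)$ is the realisation of the nerve of the poset of proper non-zero linear subspaces of $V$, ordered by inclusion. It is homotopy equivalent to a wedge of spheres of dimension $\dim(V)-2$ (Solomon--Tits), and the Steinberg module is the $\mathbb{Z}[\mathrm{GL}(V)]$-module $\mathrm{St}(V)=\widetilde{H}_{\dim(V)-2}(T(V);\mathbb{Z})$ (for $\dim V=1$, $T(V)=\varnothing$ and $\mathrm{St}(V)=\widetilde H_{-1}(\varnothing)=\mathbb{Z}$). As top-dimensional homology, $\mathrm{St}(V)$ is a subgroup of the augmented simplicial chain group $\widetilde{C}_{\dim(V)-2}(T(V))$, which is free abelian on the set of complete flags in $V$. The pairing is the restriction to $\mathrm{St}(V)$ of the bilinear form on $\widetilde{C}_{\dim(V)-2}(T(V))$ for which the set of complete flags is an orthonormal basis. *)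

theory Defs
  imports "HOL-Algebra.Free_Abelian_Groups" Complex_Main
begin

section \<open>Tensor products and coinvariants of abelian groups\<close>

text \<open>
  An element of \<open>free_Abelian_group S\<close> is a finitely supported integer-valued function
  (type \<open>'a \<Rightarrow>\<^sub>0 int\<close>) with support in \<open>S\<close>; \<open>frag_eval b\<close> is the homomorphism to the integers
  extending \<open>b\<close> linearly, the counterpart of \<open>frag_extend\<close> for integer values.
\<close>

definition frag_eval :: "('a \<Rightarrow> int) \<Rightarrow> ('a \<Rightarrow>\<^sub>0 int) \<Rightarrow> int" where
  "frag_eval b c = (\<Sum>p\<in>Poly_Mapping.keys c. Poly_Mapping.lookup c p * b p)"

definition tensor_free ::
    "('a, 'm) monoid_scheme \<Rightarrow> ('b, 'n) monoid_scheme \<Rightarrow> ('a \<times> 'b \<Rightarrow>\<^sub>0 int) monoid" where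
  "tensor_free M N = free_Abelian_group (carrier M \<times> carrier N)"

definition tensor_rels ::
    "('a, 'm) monoid_scheme \<Rightarrow> ('b, 'n) monoid_scheme \<Rightarrow> ('a \<times> 'b \<Rightarrow>\<^sub>0 int) set" where
  "tensor_rels M N = generate (tensor_free M N)
     ({frag_of (x \<otimes>\<^bsub>M\<^esub> x', y) - frag_of (x, y) - frag_of (x', y) | x x' y.
          x \<in> carrier M \<and> x' \<in> carrier M \<and> y \<in> carrier N} \<union>
      {frag_of (x, y \<otimes>\<^bsub>N\<^esub> y') - frag_of (x, y) - frag_of (x, y') | x y y'.
          x \<in> carrier M \<and> y \<in> carrier N \<and> y' \<in> carrier N})"

definition tensor_product ::
    "('a, 'm) monoid_scheme \<Rightarrow> ('b, 'n) monoid_scheme \<Rightarrow> ('a \<times> 'b \<Rightarrow>\<^sub>0 int) set monoid" where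
  "tensor_product M N = tensor_free M N Mod tensor_rels M N"

definition pure_tensor ::
    "('a, 'm) monoid_scheme \<Rightarrow> ('b, 'n) monoid_scheme \<Rightarrow> 'a \<Rightarrow> 'b \<Rightarrow> ('a \<times> 'b \<Rightarrow>\<^sub>0 int) set" where
  "pure_tensor M N x y = tensor_rels M N #>\<^bsub>tensor_free M N\<^esub> frag_of (x, y)"

text \<open>
  The endomorphism \<open>f \<otimes> f'\<close> of \<open>M \<otimes> N\<close>, for endomorphisms \<open>f\<close> of \<open>M\<close> and \<open>f'\<close> of \<open>N\<close>. Adding
  \<open>tensor_rels M N\<close> turns the image of a coset, which lies in a coset, into that coset.
\<close>

definition tensor_map ::
    "('a, 'm) monoid_scheme \<Rightarrow> ('b, 'n) monoid_scheme \<Rightarrow> ('a \<Rightarrow> 'a) \<Rightarrow> ('b \<Rightarrow> 'b) \<Rightarrow>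
     ('a \<times> 'b \<Rightarrow>\<^sub>0 int) set \<Rightarrow> ('a \<times> 'b \<Rightarrow>\<^sub>0 int) set" where
  "tensor_map M N f f' T =
     tensor_rels M N <#>\<^bsub>tensor_free M N\<^esub> (frag_extend (\<lambda>(x, y). frag_of (f x, f' y)) ` T)"

text \<open>
  The map on \<open>M \<otimes> N\<close> induced by a biadditive \<open>b\<close>, whose linear extension is constant on each
  coset of \<open>tensor_rels M N\<close>.
\<close>

definition tensor_lift :: "('a \<Rightarrow> 'b \<Rightarrow> int) \<Rightarrow> ('a \<times> 'b \<Rightarrow>\<^sub>0 int) set \<Rightarrow> int" where
  "tensor_lift b T = the_elem (frag_eval (\<lambda>(x, y). b x y) ` T)"

definition coinvariant_rels ::
    "('a, 'm) monoid_scheme \<Rightarrow> 'g set \<Rightarrow> ('g \<Rightarrow> 'a \<Rightarrow> 'a) \<Rightarrow> 'a set" where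
  "coinvariant_rels A G act = generate A {act g a \<otimes>\<^bsub>A\<^esub> inv\<^bsub>A\<^esub> a | g a. g \<in> G \<and> a \<in> carrier A}"

definition coinvariants ::
    "('a, 'm) monoid_scheme \<Rightarrow> 'g set \<Rightarrow> ('g \<Rightarrow> 'a \<Rightarrow> 'a) \<Rightarrow> 'a set monoid" where
  "coinvariants A G act = A Mod coinvariant_rels A G act"

text \<open>The map on coinvariants induced by an invariant homomorphism \<open>h\<close>, constant on cosets.\<close>

definition coinvariants_lift :: "('a \<Rightarrow> 'b) \<Rightarrow> 'a set \<Rightarrow> 'b" where
  "coinvariants_lift h X = the_elem (h ` X)"


section \<open>The Tits building and the Steinberg module\<close>

text \<open>
  The vector space is the whole type \<open>'v\<close> with scalar multiplication \<open>scale\<close>. A simplex is a flag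
  \<open>U\<^sub>1 \<subset> \<dots> \<subset> U\<^sub>k\<close> of proper non-zero subspaces, a list of length \<open>k\<close>; its dimension is \<open>k - 1\<close>.
  The index \<open>k\<close> below is the number of vertices, so \<open>tits_chains scale k\<close> sits in degree \<open>k - 1\<close>
  and the augmentation is the boundary map from \<open>k = 1\<close> to \<open>k = 0\<close>.
\<close>

definition tits_simplices :: "('k::field \<Rightarrow> 'v::ab_group_add \<Rightarrow> 'v) \<Rightarrow> nat \<Rightarrow> 'v set list set" where
  "tits_simplices scale k =
     {\<sigma>. length \<sigma> = k \<and> sorted_wrt (\<subset>) \<sigma> \<and>
         (\<forall>U\<in>set \<sigma>. module.subspace scale U \<and> U \<noteq> {0} \<and> U \<noteq> UNIV)}"

definition tits_chains ::
    "('k::field \<Rightarrow> 'v::ab_group_add \<Rightarrow> 'v) \<Rightarrow> nat \<Rightarrow> ('v set list \<Rightarrow>\<^sub>0 int) monoid" where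
  "tits_chains scale k = free_Abelian_group (tits_simplices scale k)"

definition simplicial_boundary :: "('a list \<Rightarrow>\<^sub>0 int) \<Rightarrow> ('a list \<Rightarrow>\<^sub>0 int)" where
  "simplicial_boundary =
     frag_extend (\<lambda>\<sigma>. \<Sum>i<length \<sigma>. frag_cmul ((-1) ^ i) (frag_of (take i \<sigma> @ drop (Suc i) \<sigma>)))"

definition tits_cycles ::
    "('k::field \<Rightarrow> 'v::ab_group_add \<Rightarrow> 'v) \<Rightarrow> nat \<Rightarrow> ('v set list \<Rightarrow>\<^sub>0 int) set" where
  "tits_cycles scale k = {c \<in> carrier (tits_chains scale k). simplicial_boundary c = 0}"

definition tits_boundaries ::
    "('k::field \<Rightarrow> 'v::ab_group_add \<Rightarrow> 'v) \<Rightarrow> nat \<Rightarrow> ('v set list \<Rightarrow>\<^sub>0 int) set" where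
  "tits_boundaries scale k = simplicial_boundary ` carrier (tits_chains scale (Suc k))"

definition tits_cycle_group ::
    "('k::field \<Rightarrow> 'v::ab_group_add \<Rightarrow> 'v) \<Rightarrow> nat \<Rightarrow> ('v set list \<Rightarrow>\<^sub>0 int) monoid" where
  "tits_cycle_group scale k = (tits_chains scale k)\<lparr>carrier := tits_cycles scale k\<rparr>"

definition tits_homology ::
    "('k::field \<Rightarrow> 'v::ab_group_add \<Rightarrow> 'v) \<Rightarrow> nat \<Rightarrow> ('v set list \<Rightarrow>\<^sub>0 int) set monoid" where
  "tits_homology scale k = tits_cycle_group scale k Mod tits_boundaries scale k"

text \<open>
  Complete flags have \<open>dim V - 1\<close> members. There are no longer flags, so the top reduced homology
  is the group of cycles: see \<open>steinberg_iso_homology\<close> below.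
\<close>

definition steinberg ::
    "('k::field \<Rightarrow> 'v::ab_group_add \<Rightarrow> 'v) \<Rightarrow> ('v set list \<Rightarrow>\<^sub>0 int) monoid" where
  "steinberg scale = tits_cycle_group scale (vector_space.dim scale UNIV - 1)"

definition GL :: "('k::field \<Rightarrow> 'v::ab_group_add \<Rightarrow> 'v) \<Rightarrow> ('v \<Rightarrow> 'v) set" where
  "GL scale = {g. Vector_Spaces.linear scale scale g \<and> bij g}"

definition flag_action :: "('v \<Rightarrow> 'v) \<Rightarrow> ('v set list \<Rightarrow>\<^sub>0 int) \<Rightarrow> ('v set list \<Rightarrow>\<^sub>0 int)" where
  "flag_action g = frag_extend (\<lambda>\<sigma>. frag_of (map ((`) g) \<sigma>))"

text \<open>The bilinear form on chains for which the simplices are orthonormal.\<close>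

definition flag_pairing :: "('a \<Rightarrow>\<^sub>0 int) \<Rightarrow> ('a \<Rightarrow>\<^sub>0 int) \<Rightarrow> int" where
  "flag_pairing c d =
     (\<Sum>\<sigma>\<in>Poly_Mapping.keys c. Poly_Mapping.lookup c \<sigma> * Poly_Mapping.lookup d \<sigma>)"

definition steinberg_tensor ::
    "('k::field \<Rightarrow> 'v::ab_group_add \<Rightarrow> 'v) \<Rightarrow>
     (('v set list \<Rightarrow>\<^sub>0 int) \<times> ('v set list \<Rightarrow>\<^sub>0 int) \<Rightarrow>\<^sub>0 int) set monoid" where
  "steinberg_tensor scale = tensor_product (steinberg scale) (steinberg scale)"

definition diagonal_action ::
    "('k::field \<Rightarrow> 'v::ab_group_add \<Rightarrow> 'v) \<Rightarrow> ('v \<Rightarrow> 'v) \<Rightarrow>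
     (('v set list \<Rightarrow>\<^sub>0 int) \<times> ('v set list \<Rightarrow>\<^sub>0 int) \<Rightarrow>\<^sub>0 int) set \<Rightarrow>
     (('v set list \<Rightarrow>\<^sub>0 int) \<times> ('v set list \<Rightarrow>\<^sub>0 int) \<Rightarrow>\<^sub>0 int) set" where
  "diagonal_action scale g =
     tensor_map (steinberg scale) (steinberg scale) (flag_action g) (flag_action g)"


section \<open>Well-definedness\<close>

lemma frag_eval_superset:
  assumes "finite S" "Poly_Mapping.keys c \<subseteq> S"
  shows "frag_eval b c = (\<Sum>p\<in>S. Poly_Mapping.lookup c p * b p)"
  unfolding frag_eval_def
  by (rule sum.mono_neutral_left) (use assms in \<open>auto simp: in_keys_iff\<close>)

lemma frag_eval_0 [simp]: "frag_eval b 0 = 0"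
  by (simp add: frag_eval_def)

lemma frag_eval_of [simp]: "frag_eval b (frag_of x) = b x"
  by (simp add: frag_eval_def)

lemma frag_eval_add: "frag_eval b (c + d) = frag_eval b c + frag_eval b d"
proof -
  let ?S = "Poly_Mapping.keys c \<union> Poly_Mapping.keys d"
  have "Poly_Mapping.keys (c + d) \<subseteq> ?S" by (rule Poly_Mapping.keys_add)
  then show ?thesis
    by (simp add: frag_eval_superset[of ?S] lookup_add distrib_right sum.distrib)
qed

lemma frag_eval_minus: "frag_eval b (- c) = - frag_eval b c"
  by (simp add: frag_eval_def sum_negf)

lemma frag_eval_diff: "frag_eval b (c - d) = frag_eval b c - frag_eval b d"
  using frag_eval_add[of b c "- d"] by (simp add: frag_eval_minus)

lemma flag_pairing_eval: "flag_pairing c d = frag_eval (Poly_Mapping.lookup d) c"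
  by (simp add: flag_pairing_def frag_eval_def)

lemma flag_pairing_of: "flag_pairing (frag_of \<sigma>) (frag_of \<tau>) = (if \<sigma> = \<tau> then 1 else 0)"
  by (simp add: flag_pairing_eval)

lemma flag_pairing_commute: "flag_pairing c d = flag_pairing d c"
proof -
  let ?S = "Poly_Mapping.keys c \<union> Poly_Mapping.keys d"
  show ?thesis
    unfolding flag_pairing_eval
    by (simp add: frag_eval_superset[of ?S] mult.commute)
qed

lemma flag_pairing_add_left: "flag_pairing (c + c') d = flag_pairing c d + flag_pairing c' d"
  by (simp add: flag_pairing_eval frag_eval_add)

lemma flag_pairing_add_right: "flag_pairing c (d + d') = flag_pairing c d + flag_pairing c d'"
  by (metis flag_pairing_add_left flag_pairing_commute)

lemma flag_pairing_diff_left: "flag_pairing (c - c') d = flag_pairing c d - flag_pairing c' d"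
  by (simp add: flag_pairing_eval frag_eval_diff)

lemma flag_pairing_diff_right: "flag_pairing c (d - d') = flag_pairing c d - flag_pairing c d'"
  by (metis flag_pairing_diff_left flag_pairing_commute)

lemma flag_pairing_zero_left [simp]: "flag_pairing 0 d = 0"
  by (simp add: flag_pairing_def)

lemma flag_pairing_zero_right [simp]: "flag_pairing c 0 = 0"
  by (simp add: flag_pairing_def)

lemma flag_pairing_invariant:
  assumes "inj g"
  shows "flag_pairing (flag_action g c) (flag_action g d) = flag_pairing c d"
proof -
  have inj: "inj (map ((`) g))"
    using assms by (simp add: inj_image_eq_iff inj_def)
  have "Poly_Mapping.keys c \<subseteq> UNIV" by simp
  then show ?thesis
  proof (induction c rule: frag_induction)
    case (one \<sigma>)
    have "Poly_Mapping.keys d \<subseteq> UNIV" by simp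
    then show ?case
    proof (induction d rule: frag_induction)
      case (one \<tau>)
      then show ?case
        by (simp add: flag_action_def flag_pairing_of inj_eq[OF inj])
    qed (simp_all add: flag_action_def frag_extend_diff flag_pairing_diff_right)
  qed (simp_all add: flag_action_def frag_extend_diff flag_pairing_diff_left)
qed

lemma tits_simplices_empty:
  assumes "finite_dimensional_vector_space scale B" and "vector_space.dim scale UNIV \<le> k" "0 < k"
  shows "tits_simplices scale k = {}"
proof (rule ccontr)
  interpret finite_dimensional_vector_space scale B by fact
  assume "tits_simplices scale k \<noteq> {}"
  then obtain \<sigma> where len: "length \<sigma> = k" and sorted: "sorted_wrt (\<subset>) \<sigma>"
    and sub: "\<And>U. U \<in> set \<sigma> \<Longrightarrow> subspace U \<and> U \<noteq> {0} \<and> U \<noteq> UNIV"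
    by (auto simp: tits_simplices_def)
  have less: "dim U < dim W" if "subspace U" "subspace W" "U \<subset> W" for U W
    using dim_psubset[of U W] that by (metis span_eq_iff)
  have "Suc i \<le> dim (\<sigma> ! i)" if "i < k" for i
    using that
  proof (induction i)
    case 0
    have U: "subspace (\<sigma> ! 0)" "\<sigma> ! 0 \<noteq> {0}" using sub len 0 by auto
    then have "{0} \<subset> \<sigma> ! 0" using subspace_0 by auto
    from less[OF _ U(1) this] show ?case by (simp add: subspace_single_0)
  next
    case (Suc i)
    have "dim (\<sigma> ! i) < dim (\<sigma> ! Suc i)"
      using Suc.prems len by (intro less) (auto simp: sub sorted_wrt_nth_less[OF sorted])
    with Suc show ?case by simp
  qed
  from this[of "k - 1"] have "k \<le> dim (\<sigma> ! (k - 1))" using assms(3) by simp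
  moreover have "dim (\<sigma> ! (k - 1)) < dim UNIV"
    using assms(3) len sub[of "\<sigma> ! (k - 1)"] by (intro less) (auto simp: subspace_UNIV)
  ultimately show False using assms(2) by simp
qed

lemma simplicial_boundary_0 [simp]: "simplicial_boundary 0 = 0"
  by (simp add: simplicial_boundary_def)

lemma simplicial_boundary_add:
  "simplicial_boundary (c + d) = simplicial_boundary c + simplicial_boundary d"
  by (simp add: simplicial_boundary_def frag_extend_add)

lemma simplicial_boundary_minus: "simplicial_boundary (- c) = - simplicial_boundary c"
  by (simp add: simplicial_boundary_def frag_extend_minus)

lemma subgroup_tits_cycles: "subgroup (tits_cycles scale k) (tits_chains scale k)"
proof (rule group.subgroupI)
  show "group (tits_chains scale k)" by (simp add: tits_chains_def)
  show "tits_cycles scale k \<noteq> {}"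
    by (auto simp: tits_cycles_def tits_chains_def intro!: exI[of _ 0])
  fix c d assume "c \<in> tits_cycles scale k" "d \<in> tits_cycles scale k"
  then show "inv\<^bsub>tits_chains scale k\<^esub> c \<in> tits_cycles scale k"
    and "c \<otimes>\<^bsub>tits_chains scale k\<^esub> d \<in> tits_cycles scale k"
    using Poly_Mapping.keys_add[of c d]
    by (auto simp: tits_cycles_def tits_chains_def simplicial_boundary_add simplicial_boundary_minus)
qed (auto simp: tits_cycles_def)

lemma comm_group_tits_cycle_group: "comm_group (tits_cycle_group scale k)"
proof -
  interpret comm_group "tits_chains scale k"
    by (simp add: tits_chains_def abelian_free_Abelian_group)
  have "group (tits_cycle_group scale k)"
    unfolding tits_cycle_group_def by (rule subgroup_imp_group[OF subgroup_tits_cycles])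
  then show ?thesis
    by (rule group.group_comm_groupI) (simp add: tits_cycle_group_def tits_chains_def add.commute)
qed

lemma comm_group_steinberg: "comm_group (steinberg scale)"
  by (simp add: steinberg_def comm_group_tits_cycle_group)

lemma mult_steinberg: "c \<otimes>\<^bsub>steinberg scale\<^esub> d = c + d"
  by (simp add: steinberg_def tits_cycle_group_def tits_chains_def)

lemma carrier_steinberg:
  "c \<in> carrier (steinberg scale) \<longleftrightarrow>
     Poly_Mapping.keys c \<subseteq> tits_simplices scale (vector_space.dim scale UNIV - 1) \<and>
     simplicial_boundary c = 0"
  by (simp add: steinberg_def tits_cycle_group_def tits_cycles_def tits_chains_def)

theorem steinberg_iso_homology:
  assumes "finite_dimensional_vector_space scale B" and "(UNIV :: 'v::ab_group_add set) \<noteq> {0}"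
  shows "(\<lambda>c :: 'v set list \<Rightarrow>\<^sub>0 int. {c}) \<in>
    iso (steinberg scale) (tits_homology scale (vector_space.dim scale UNIV - 1))"
proof -
  interpret finite_dimensional_vector_space scale B by fact
  let ?n = "dim UNIV - 1"
  have B: "tits_boundaries scale ?n = {0}"
    using tits_simplices_empty[OF assms(1), of "Suc ?n"]
    by (auto simp: tits_boundaries_def tits_chains_def)
  have mult: "monoid.mult (tits_cycle_group scale k) x y = x + y" for k x y
    by (simp add: tits_cycle_group_def tits_chains_def)
  have "carrier (tits_homology scale ?n) = (\<lambda>c. {c}) ` carrier (steinberg scale)"
    unfolding tits_homology_def B FactGroup_def RCOSETS_def r_coset_def steinberg_def mult
    by auto
  moreover have "{c} \<otimes>\<^bsub>tits_homology scale ?n\<^esub> {d} = {c \<otimes>\<^bsub>steinberg scale\<^esub> d}" for c d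
    unfolding tits_homology_def FactGroup_def set_mult_def steinberg_def mult monoid.simps by (simp add: mult[simplified])
  ultimately show ?thesis
    by (simp add: iso_def hom_def bij_betw_def inj_on_def)
qed

lemma simplicial_boundary_flag_action:
  "simplicial_boundary (flag_action g c) = flag_action g (simplicial_boundary c)"
proof -
  have "Poly_Mapping.keys c \<subseteq> UNIV" by simp
  then show ?thesis
  proof (induction c rule: frag_induction)
    case (one \<sigma>)
    then show ?case
      by (simp add: flag_action_def simplicial_boundary_def frag_extend_sum frag_extend_cmul
          take_map drop_map o_def)
  qed (simp_all add: flag_action_def simplicial_boundary_def frag_extend_diff)
qed

lemma map_image_tits_simplices:
  assumes g: "g \<in> GL scale" and \<sigma>: "\<sigma> \<in> tits_simplices scale k"
  shows "map ((`) g) \<sigma> \<in> tits_simplices scale k"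
proof -
  interpret Vector_Spaces.linear scale scale g using g by (simp add: GL_def)
  have bij: "bij g" using g by (simp add: GL_def)
  have strict: "g ` U \<subset> g ` W \<longleftrightarrow> U \<subset> W" for U W
    using bij by (simp add: psubset_eq inj_image_subset_iff inj_image_eq_iff bij_is_inj)
  have "g ` U \<noteq> {0}" if "U \<noteq> {0}" for U
    using inj_image_eq_iff[OF bij_is_inj[OF bij], of U "{0}"] that by simp
  moreover have "g ` U \<noteq> UNIV" if "U \<noteq> UNIV" for U
    using inj_image_eq_iff[OF bij_is_inj[OF bij], of U UNIV] that bij_is_surj[OF bij] by simp
  ultimately show ?thesis
    using \<sigma> by (auto simp: tits_simplices_def sorted_wrt_map strict subspace_image)
qed

lemma flag_action_in_steinberg:
  assumes g: "g \<in> GL scale" and c: "c \<in> carrier (steinberg scale)"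
  shows "flag_action g c \<in> carrier (steinberg scale)"
proof -
  let ?S = "tits_simplices scale (vector_space.dim scale UNIV - 1)"
  have keys: "Poly_Mapping.keys (flag_action g c) \<subseteq> ?S"
    using c keys_frag_extend[of "\<lambda>\<sigma>. frag_of (map ((`) g) \<sigma>)" c]
      map_image_tits_simplices[OF g]
    by (fastforce simp: carrier_steinberg flag_action_def)
  then show ?thesis
    using c by (simp add: carrier_steinberg simplicial_boundary_flag_action)
       (simp add: flag_action_def)
qed

lemma flag_action_add: "flag_action g (c + d) = flag_action g c + flag_action g d"
  by (simp add: flag_action_def frag_extend_add)

lemma hom_rcoset_generate:
  assumes G: "comm_group G" and H: "group H" and h: "h \<in> hom G H"
    and S: "S \<subseteq> carrier G" "\<And>s. s \<in> S \<Longrightarrow> h s \<in> K" and K: "subgroup K H"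
    and x: "x \<in> carrier G" and c: "c \<in> generate G S #>\<^bsub>G\<^esub> x"
  shows "h c \<in> K #>\<^bsub>H\<^esub> h x"
proof -
  interpret G: comm_group G by fact
  interpret H: group H by fact
  interpret group_hom G H h by unfold_locales (rule h)
  have "h s \<in> K" if "s \<in> generate G S" for s
    using that
  proof (induction s rule: generate.induct)
    case one then show ?case using K by (simp add: subgroup.one_closed)
  next
    case (incl s) then show ?case using S by simp
  next
    case (inv s)
    then have "s \<in> carrier G" using S by auto
    then show ?case using inv S K by (simp add: subgroup.m_inv_closed)
  next
    case (eng s t)
    then have "s \<in> carrier G" "t \<in> carrier G" using G.generate_in_carrier[OF S(1)] by auto
    then show ?case using eng K by (simp add: subgroup.m_closed)
  qed
  moreover obtain s where "s \<in> generate G S" "c = s \<otimes>\<^bsub>G\<^esub> x"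
    using c by (auto simp: r_coset_def)
  ultimately show ?thesis
    using x G.generate_in_carrier[OF S(1)] by (auto simp: r_coset_def)
qed

lemma the_elem_image_rcoset_generate:
  assumes G: "comm_group G" and H: "group H" and h: "h \<in> hom G H"
    and S: "S \<subseteq> carrier G" "\<And>s. s \<in> S \<Longrightarrow> h s = \<one>\<^bsub>H\<^esub>" and x: "x \<in> carrier G"
  shows "the_elem (h ` (generate G S #>\<^bsub>G\<^esub> x)) = h x"
proof -
  interpret G: comm_group G by fact
  interpret H: group H by fact
  have hx: "h x \<in> carrier H" using h x by (auto simp: hom_def)
  have "h c = h x" if "c \<in> generate G S #>\<^bsub>G\<^esub> x" for c
    using hom_rcoset_generate[OF G H h S(1) _ H.triv_subgroup x that] S(2) hx
    by (auto simp: r_coset_def)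
  moreover have "x \<in> generate G S #>\<^bsub>G\<^esub> x"
    using x G.generate_is_subgroup[OF S(1)] by (simp add: G.rcos_self)
  ultimately have "h ` (generate G S #>\<^bsub>G\<^esub> x) = {h x}" by blast
  then show ?thesis by simp
qed

definition biadditive ::
    "('a, 'm) monoid_scheme \<Rightarrow> ('b, 'n) monoid_scheme \<Rightarrow> ('a \<Rightarrow> 'b \<Rightarrow> int) \<Rightarrow> bool" where
  "biadditive M N b \<longleftrightarrow>
     (\<forall>x\<in>carrier M. \<forall>x'\<in>carrier M. \<forall>y\<in>carrier N. b (x \<otimes>\<^bsub>M\<^esub> x') y = b x y + b x' y) \<and>
     (\<forall>x\<in>carrier M. \<forall>y\<in>carrier N. \<forall>y'\<in>carrier N. b x (y \<otimes>\<^bsub>N\<^esub> y') = b x y + b x y')"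

lemma biadditive_flag_pairing: "biadditive (steinberg scale) (steinberg scale) flag_pairing"
  by (simp add: biadditive_def mult_steinberg flag_pairing_add_left flag_pairing_add_right)

lemma comm_group_tensor_free: "comm_group (tensor_free M N)"
  by (simp add: tensor_free_def abelian_free_Abelian_group)

lemma frag_of_in_tensor_free:
  "x \<in> carrier M \<Longrightarrow> y \<in> carrier N \<Longrightarrow> frag_of (x, y) \<in> carrier (tensor_free M N)"
  by (simp add: tensor_free_def)

lemma diff_in_tensor_free:
  assumes "c \<in> carrier (tensor_free M N)" "d \<in> carrier (tensor_free M N)"
  shows "c - d \<in> carrier (tensor_free M N)"
  using assms keys_diff[of c d] by (auto simp: tensor_free_def)

lemma tensor_rels_gens_subset:
  assumes "group M" "group N"
  shows "{frag_of (x \<otimes>\<^bsub>M\<^esub> x', y) - frag_of (x, y) - frag_of (x', y) | x x' y.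
            x \<in> carrier M \<and> x' \<in> carrier M \<and> y \<in> carrier N} \<union>
         {frag_of (x, y \<otimes>\<^bsub>N\<^esub> y') - frag_of (x, y) - frag_of (x, y') | x y y'.
            x \<in> carrier M \<and> y \<in> carrier N \<and> y' \<in> carrier N} \<subseteq> carrier (tensor_free M N)"
proof -
  interpret M: group M by fact
  interpret N: group N by fact
  show ?thesis
    by (auto intro!: diff_in_tensor_free frag_of_in_tensor_free)
qed

lemma subgroup_tensor_rels:
  assumes "group M" "group N"
  shows "subgroup (tensor_rels M N) (tensor_free M N)"
  unfolding tensor_rels_def
  by (intro group.generate_is_subgroup tensor_rels_gens_subset assms)
     (simp add: tensor_free_def)

lemma comm_group_tensor_product:
  assumes "group M" "group N"
  shows "comm_group (tensor_product M N)"
  unfolding tensor_product_def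
  by (intro comm_group.abelian_FactGroup comm_group_tensor_free subgroup_tensor_rels assms)

lemma tensor_lift_coset:
  assumes "group M" "group N" "biadditive M N b" "c \<in> carrier (tensor_free M N)"
  shows "tensor_lift b (tensor_rels M N #>\<^bsub>tensor_free M N\<^esub> c) = frag_eval (\<lambda>(x, y). b x y) c"
  unfolding tensor_lift_def tensor_rels_def
proof (rule the_elem_image_rcoset_generate[where H = integer_group])
  show "frag_eval (\<lambda>(x, y). b x y) \<in> hom (tensor_free M N) integer_group"
    by (simp add: hom_def tensor_free_def frag_eval_add)
qed (use assms tensor_rels_gens_subset[OF assms(1,2)] comm_group_tensor_free in
      \<open>auto simp: frag_eval_diff biadditive_def\<close>)

theorem tensor_lift_pure:
  assumes "group M" "group N" "biadditive M N b" "x \<in> carrier M" "y \<in> carrier N"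
  shows "tensor_lift b (pure_tensor M N x y) = b x y"
  using tensor_lift_coset[OF assms(1-3) frag_of_in_tensor_free[OF assms(4,5)]]
  by (simp add: pure_tensor_def)

lemma tensor_product_cases:
  assumes "T \<in> carrier (tensor_product M N)"
  obtains c where "c \<in> carrier (tensor_free M N)" "T = tensor_rels M N #>\<^bsub>tensor_free M N\<^esub> c"
  using assms by (auto simp: tensor_product_def FactGroup_def RCOSETS_def)

lemma tensor_product_mult:
  assumes "group M" "group N" "c \<in> carrier (tensor_free M N)" "d \<in> carrier (tensor_free M N)"
  shows "(tensor_rels M N #>\<^bsub>tensor_free M N\<^esub> c) \<otimes>\<^bsub>tensor_product M N\<^esub>
           (tensor_rels M N #>\<^bsub>tensor_free M N\<^esub> d) =
         tensor_rels M N #>\<^bsub>tensor_free M N\<^esub> (c + d)"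
proof -
  have "tensor_rels M N \<lhd> tensor_free M N"
    using comm_group.subgroup_imp_normal[OF comm_group_tensor_free subgroup_tensor_rels] assms
    by blast
  from normal.rcos_sum[OF this assms(3,4)] show ?thesis
    by (simp add: tensor_product_def) (simp add: tensor_free_def)
qed

lemma tensor_lift_hom:
  assumes "group M" "group N" "biadditive M N b"
  shows "tensor_lift b \<in> hom (tensor_product M N) integer_group"
proof (rule homI)
  fix T U assume "T \<in> carrier (tensor_product M N)" "U \<in> carrier (tensor_product M N)"
  then obtain c d where *: "c \<in> carrier (tensor_free M N)" "d \<in> carrier (tensor_free M N)"
    and T: "T = tensor_rels M N #>\<^bsub>tensor_free M N\<^esub> c"
    and U: "U = tensor_rels M N #>\<^bsub>tensor_free M N\<^esub> d"
    by (metis tensor_product_cases)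
  have "c + d \<in> carrier (tensor_free M N)"
    using * keys_add[of c d] by (auto simp: tensor_free_def)
  then show "tensor_lift b (T \<otimes>\<^bsub>tensor_product M N\<^esub> U) =
      tensor_lift b T \<otimes>\<^bsub>integer_group\<^esub> tensor_lift b U"
    using * by (simp add: T U tensor_product_mult[OF assms(1,2)] tensor_lift_coset[OF assms]
        frag_eval_add)
qed simp

theorem tensor_map_coset:
  assumes M: "group M" and N: "group N" and f: "f \<in> hom M M" and f': "f' \<in> hom N N"
    and c: "c \<in> carrier (tensor_free M N)"
  shows "tensor_map M N f f' (tensor_rels M N #>\<^bsub>tensor_free M N\<^esub> c) =
         tensor_rels M N #>\<^bsub>tensor_free M N\<^esub> frag_extend (\<lambda>(x, y). frag_of (f x, f' y)) c"
    and "frag_extend (\<lambda>(x, y). frag_of (f x, f' y)) c \<in> carrier (tensor_free M N)"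
proof -
  let ?F = "tensor_free M N" and ?R = "tensor_rels M N"
  let ?h = "frag_extend (\<lambda>(x, y). frag_of (f x, f' y))"
  interpret F: comm_group ?F by (rule comm_group_tensor_free)
  note R = subgroup_tensor_rels[OF M N]
  have carr: "?h d \<in> carrier ?F" if d: "d \<in> carrier ?F" for d
  proof -
    have "Poly_Mapping.keys (case p of (x, y) \<Rightarrow> frag_of (f x, f' y)) \<subseteq> carrier M \<times> carrier N"
      if "p \<in> Poly_Mapping.keys d" for p
      using that d hom_in_carrier[OF f] hom_in_carrier[OF f']
      by (auto simp: tensor_free_def split: prod.splits)
    then show ?thesis
      using keys_frag_extend[of "\<lambda>(x, y). frag_of (f x, f' y)" d]
      unfolding tensor_free_def carrier_free_Abelian_group_iff by (meson UN_least order_trans)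
  qed
  then show hc: "?h c \<in> carrier ?F" using c by blast
  have hom: "?h \<in> hom ?F ?F"
    using carr by (simp add: hom_def) (simp add: tensor_free_def frag_extend_add)
  have coset: "?h d \<in> ?R #>\<^bsub>?F\<^esub> ?h c" if "d \<in> ?R #>\<^bsub>?F\<^esub> c" for d
  proof (rule hom_rcoset_generate[OF F.comm_group_axioms F.group_axioms hom
        tensor_rels_gens_subset[OF M N] _ R c that[unfolded tensor_rels_def]], goal_cases)
    case (1 s)
    then consider
        x x' y where "x \<in> carrier M" "x' \<in> carrier M" "y \<in> carrier N"
          "s = frag_of (x \<otimes>\<^bsub>M\<^esub> x', y) - frag_of (x, y) - frag_of (x', y)"
      | x y y' where "x \<in> carrier M" "y \<in> carrier N" "y' \<in> carrier N"
          "s = frag_of (x, y \<otimes>\<^bsub>N\<^esub> y') - frag_of (x, y) - frag_of (x, y')"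
      by blast
    then show ?case
    proof cases
      case 1
      then have "?h s = frag_of (f x \<otimes>\<^bsub>M\<^esub> f x', f' y) - frag_of (f x, f' y) - frag_of (f x', f' y)"
        by (simp add: frag_extend_diff hom_mult[OF f])
      then show ?thesis
        unfolding tensor_rels_def using 1 hom_in_carrier[OF f] hom_in_carrier[OF f']
        by (intro generate.incl) blast
    next
      case 2
      then have "?h s = frag_of (f x, f' y \<otimes>\<^bsub>N\<^esub> f' y') - frag_of (f x, f' y) - frag_of (f x, f' y')"
        by (simp add: frag_extend_diff hom_mult[OF f'])
      then show ?thesis
        unfolding tensor_rels_def using 2 hom_in_carrier[OF f] hom_in_carrier[OF f']
        by (intro generate.incl) blast
    qed
  qed
  have "?R <#>\<^bsub>?F\<^esub> (?h ` (?R #>\<^bsub>?F\<^esub> c)) = (\<Union>d\<in>?R #>\<^bsub>?F\<^esub> c. ?R #>\<^bsub>?F\<^esub> ?h d)"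
    by (auto simp: set_mult_def r_coset_def)
  also have "\<dots> = (\<Union>d\<in>?R #>\<^bsub>?F\<^esub> c. ?R #>\<^bsub>?F\<^esub> ?h c)"
    using F.repr_independence[OF coset hc R] by simp
  also have "\<dots> = ?R #>\<^bsub>?F\<^esub> ?h c"
    using F.rcos_self[OF c R] by auto
  finally show "tensor_map M N f f' (?R #>\<^bsub>?F\<^esub> c) = ?R #>\<^bsub>?F\<^esub> ?h c"
    by (simp add: tensor_map_def)
qed

corollary tensor_map_pure:
  assumes "group M" "group N" "f \<in> hom M M" "f' \<in> hom N N" "x \<in> carrier M" "y \<in> carrier N"
  shows "tensor_map M N f f' (pure_tensor M N x y) = pure_tensor M N (f x) (f' y)"
  using tensor_map_coset(1)[OF assms(1-4) frag_of_in_tensor_free[OF assms(5,6)]]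
  by (simp add: pure_tensor_def)

lemma flag_action_hom:
  "g \<in> GL scale \<Longrightarrow> flag_action g \<in> hom (steinberg scale) (steinberg scale)"
  by (simp add: hom_def flag_action_in_steinberg mult_steinberg flag_action_add)

lemma group_steinberg: "group (steinberg scale)"
  using comm_group_steinberg by (rule comm_group.axioms)

lemma diagonal_action_closed_invariant:
  assumes g: "g \<in> GL scale" and T: "T \<in> carrier (steinberg_tensor scale)"
  shows "diagonal_action scale g T \<in> carrier (steinberg_tensor scale)"
    and "tensor_lift flag_pairing (diagonal_action scale g T) = tensor_lift flag_pairing T"
proof -
  let ?S = "steinberg scale"
  let ?h = "frag_extend (\<lambda>(x, y). frag_of (flag_action g x, flag_action g y))"
  let ?e = "frag_eval (\<lambda>(x, y). flag_pairing x y)"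
  obtain c where c: "c \<in> carrier (tensor_free ?S ?S)"
    and T: "T = tensor_rels ?S ?S #>\<^bsub>tensor_free ?S ?S\<^esub> c"
    using T unfolding steinberg_tensor_def by (rule tensor_product_cases)
  note map = tensor_map_coset[OF group_steinberg group_steinberg
      flag_action_hom[OF g] flag_action_hom[OF g] c]
  then show "diagonal_action scale g T \<in> carrier (steinberg_tensor scale)"
    by (auto simp: T diagonal_action_def steinberg_tensor_def tensor_product_def
        FactGroup_def RCOSETS_def)
  have "inj g" using g by (simp add: GL_def bij_is_inj)
  have "Poly_Mapping.keys c \<subseteq> UNIV" by simp
  then have "?e (?h c) = ?e c"
    by (induction c rule: frag_induction)
       (auto simp: frag_extend_diff frag_eval_diff flag_pairing_invariant[OF \<open>inj g\<close>])
  then show "tensor_lift flag_pairing (diagonal_action scale g T) = tensor_lift flag_pairing T"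
    using map c
    by (simp add: T diagonal_action_def
        tensor_lift_coset[OF group_steinberg group_steinberg biadditive_flag_pairing])
qed

theorem coinvariants_lift_coset:
  assumes A: "comm_group A" and H: "group H" and h: "h \<in> hom A H"
    and act: "\<And>g a. g \<in> G \<Longrightarrow> a \<in> carrier A \<Longrightarrow> act g a \<in> carrier A \<and> h (act g a) = h a"
    and x: "x \<in> carrier A"
  shows "coinvariants_lift h (coinvariant_rels A G act #>\<^bsub>A\<^esub> x) = h x"
proof -
  interpret A: comm_group A by fact
  interpret H: group H by fact
  interpret group_hom A H h by unfold_locales (rule h)
  show ?thesis
    unfolding coinvariants_lift_def coinvariant_rels_def
    by (rule the_elem_image_rcoset_generate[OF A H h _ _ x]) (auto simp: act)
qed

theorem steinberg_coinvariants_lift: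
  assumes c: "c \<in> carrier (steinberg scale)" and d: "d \<in> carrier (steinberg scale)"
  shows "coinvariants_lift (tensor_lift flag_pairing)
     (coinvariant_rels (steinberg_tensor scale) (GL scale) (diagonal_action scale)
        #>\<^bsub>steinberg_tensor scale\<^esub> pure_tensor (steinberg scale) (steinberg scale) c d) =
     flag_pairing c d"
proof -
  have "pure_tensor (steinberg scale) (steinberg scale) c d \<in> carrier (steinberg_tensor scale)"
    using frag_of_in_tensor_free[OF c d]
    by (auto simp: pure_tensor_def steinberg_tensor_def tensor_product_def
        FactGroup_def RCOSETS_def)
  moreover have "tensor_lift flag_pairing \<in> hom (steinberg_tensor scale) integer_group"
    unfolding steinberg_tensor_def
    by (intro tensor_lift_hom group_steinberg biadditive_flag_pairing)
  moreover have "comm_group (steinberg_tensor scale)"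
    unfolding steinberg_tensor_def by (intro comm_group_tensor_product group_steinberg)
  ultimately show ?thesis
    by (simp add: coinvariants_lift_coset[where H = integer_group]
        diagonal_action_closed_invariant
        tensor_lift_pure[OF group_steinberg group_steinberg biadditive_flag_pairing c d])
qed

end

theory Submission
  imports Defs
begin

text \<open>
  Write \<open>St V\<close> for the Steinberg module. The induced map on coinvariants is an isomorphism as soon as
  two things hold: some pair of cycles has pairing \<open>1\<close> (\<open>exists_pairing_one\<close>), and every
  \<open>GL V\<close>-invariant biadditive form \<open>b\<close> on \<open>St V\<close>, with values in any abelian group, has the shape
  \<open>b x y = \<langle>x, y\<rangle> m\<close> for a fixed value \<open>m\<close> (\<open>invariant_form_is_multiple_of_pairing\<close>). Applied to the
  universal form \<open>(x, y) \<mapsto> [x \<otimes> y]\<close>, the second statement says that the coinvariants are generated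
  by a single class, so that nothing is left in the kernel of the map to the integers.

  Invariant forms are analysed by induction on the dimension, for a group smaller than \<open>GL V\<close>:
  the stabiliser of a non-zero vector \<open>v\<close>. A cycle is called generic for \<open>v\<close> if no proper subspace
  in any flag of its support contains \<open>v\<close>. The claim proved by induction
  (\<open>generic_form_is_multiple_of_pairing\<close>) is that a form invariant under the stabiliser of \<open>v\<close>
  agrees with a multiple of the pairing whenever its first argument is generic for \<open>v\<close>.

  The inductive step uses suspensions. If \<open>V = K \<oplus> \<langle>u\<rangle>\<close>, a cycle \<open>c\<close> of \<open>St K\<close> has a suspension
  \<open>S\<^sub>u c\<close> in \<open>St V\<close>, the difference of the cones over \<open>c\<close> with apexes \<open>K\<close> and \<open>\<langle>u\<rangle>\<close>.
  Every \<open>y\<close> in \<open>St V\<close> is a sum of suspensions \<open>S\<^sub>v y'\<close> along the fixed line \<open>\<langle>v\<rangle>\<close>, over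
  varying hyperplanes \<open>K\<close> that do not contain \<open>v\<close> (\<open>St_line_decomposition\<close>). Once \<open>K\<close> is chosen,
  every \<open>x\<close> is, up to sign, a sum of suspensions \<open>S\<^bsub>v+k\<^esub> x\<^sub>k\<close> along varying lines, with the fixed hyperplane \<open>K\<close>
  (\<open>St_hyperplane_decomposition\<close>); and if \<open>x\<close> is generic for \<open>v\<close>, then the vectors \<open>k\<close> that occur
  are non-zero and \<open>x\<^sub>k\<close> is generic for \<open>k\<close>. Now \<open>(x', y') \<mapsto> b (S\<^bsub>v+k\<^esub> x') (S\<^sub>v y')\<close> is a
  form on \<open>St K\<close> that is invariant under the stabiliser of \<open>k\<close>, so the induction hypothesis applies to it;
  and for \<open>x'\<close> generic for \<open>k\<close> the pairing of \<open>S\<^bsub>v+k\<^esub> x'\<close> with \<open>S\<^sub>v y'\<close> is the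
  pairing of \<open>x'\<close> with \<open>y'\<close>. The multiple \<open>m\<close> does not depend on \<open>K\<close> and \<open>k\<close>, because the stabiliser of \<open>v\<close>
  permutes these pairs transitively.

  Finally, \<open>GL V\<close> is transitive on non-zero vectors, so for a \<open>GL V\<close>-invariant form the multiple does
  not depend on \<open>v\<close> either, and the cycles that are generic for some \<open>v\<close> generate \<open>St V\<close>
  (\<open>St_generated_by_generic\<close>), since the suspension \<open>S\<^sub>v\<close> of a cycle generic for \<open>k\<close> is
  generic for \<open>v + k\<close>.
\<close>

section \<open>Chains on lists\<close>

lemma frag_extend_frag_extend:
  "frag_extend f (frag_extend g c) = frag_extend (\<lambda>x. frag_extend f (g x)) c"
  using subset_UNIV[of "Poly_Mapping.keys c"]
  by (induction c rule: frag_induction) (simp_all add: frag_extend_diff)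

lemma frag_extend_frag_of [simp]: "frag_extend frag_of c = c"
  by (rule frag_expansion[symmetric])

lemma keys_frag_extend_in:
  assumes "F \<in> Poly_Mapping.keys (frag_extend f c)"
  obtains G where "G \<in> Poly_Mapping.keys c" "F \<in> Poly_Mapping.keys (f G)"
  using assms keys_frag_extend[of f c] by blast

lemma lookup_frag_extend_restrict:
  "Poly_Mapping.lookup (frag_extend (\<lambda>F. if P F then frag_of F else 0) c) F =
     (if P F then Poly_Mapping.lookup c F else 0)"
  using subset_UNIV[of "Poly_Mapping.keys c"]
  by (induction c rule: frag_induction) (simp_all add: frag_extend_diff lookup_minus)

lemma frag_cmul_diff: "frag_cmul k (c - d) = frag_cmul k c - frag_cmul k d"
  by (rule poly_mapping_eqI) (simp add: lookup_minus right_diff_distrib)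

lemma frag_extend_cmul_fun:
  "frag_extend (\<lambda>x. frag_cmul k (f x)) c = frag_cmul k (frag_extend f c)"
  using subset_UNIV[of "Poly_Mapping.keys c"]
  by (induction c rule: frag_induction) (simp_all add: frag_extend_diff frag_cmul_diff)

text \<open>
  A chain on flags is handled by recursion on the first entry of its lists: \<open>link a\<close> collects the terms
  that start with \<open>a\<close>, so a chain is the sum of the \<open>prepend a (link a c)\<close>, while \<open>behead\<close> sums all the links.
\<close>

definition prepend :: "'a \<Rightarrow> ('a list \<Rightarrow>\<^sub>0 int) \<Rightarrow> ('a list \<Rightarrow>\<^sub>0 int)" where
  "prepend a = frag_extend (\<lambda>F. frag_of (a # F))"

definition link :: "'a \<Rightarrow> ('a list \<Rightarrow>\<^sub>0 int) \<Rightarrow> ('a list \<Rightarrow>\<^sub>0 int)" where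
  "link a = frag_extend (\<lambda>F. case F of [] \<Rightarrow> 0 | b # G \<Rightarrow> if b = a then frag_of G else 0)"

definition behead :: "('a list \<Rightarrow>\<^sub>0 int) \<Rightarrow> ('a list \<Rightarrow>\<^sub>0 int)" where
  "behead = frag_extend (\<lambda>F. case F of [] \<Rightarrow> 0 | b # G \<Rightarrow> frag_of G)"

lemma prepend_simps [simp]:
  "prepend a 0 = 0" "prepend a (frag_of F) = frag_of (a # F)"
  "prepend a (c - d) = prepend a c - prepend a d"
  "prepend a (frag_cmul k c) = frag_cmul k (prepend a c)"
  "finite I \<Longrightarrow> prepend a (\<Sum>i\<in>I. e i) = (\<Sum>i\<in>I. prepend a (e i))"
  by (simp_all add: prepend_def frag_extend_diff frag_extend_cmul frag_extend_sum o_def)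

lemma link_simps [simp]:
  "link a 0 = 0" "link a (frag_of []) = 0"
  "link a (frag_of (b # F)) = (if b = a then frag_of F else 0)"
  "link a (c - d) = link a c - link a d"
  by (simp_all add: link_def frag_extend_diff)

lemma behead_simps [simp]:
  "behead 0 = 0" "behead (frag_of []) = 0" "behead (frag_of (b # F)) = frag_of F"
  "behead (c - d) = behead c - behead d"
  by (simp_all add: behead_def frag_extend_diff)

lemma keys_prepend: "Poly_Mapping.keys (prepend a c) \<subseteq> (#) a ` Poly_Mapping.keys c"
  using keys_frag_extend[of "\<lambda>F. frag_of (a # F)" c] by (auto simp: prepend_def)

lemma lookup_link: "Poly_Mapping.lookup (link a c) F = Poly_Mapping.lookup c (a # F)"
  using subset_UNIV[of "Poly_Mapping.keys c"]
proof (induction c rule: frag_induction)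
  case (one G)
  then show ?case by (cases G) auto
qed (simp_all add: lookup_minus)

lemma keys_link: "F \<in> Poly_Mapping.keys (link a c) \<longleftrightarrow> a # F \<in> Poly_Mapping.keys c"
  by (simp add: in_keys_iff lookup_link)

lemma lookup_prepend [simp]:
  "Poly_Mapping.lookup (prepend a c) (b # F) = (if b = a then Poly_Mapping.lookup c F else 0)"
  using subset_UNIV[of "Poly_Mapping.keys c"]
  by (induction c rule: frag_induction) (auto simp: lookup_minus)

lemma lookup_prepend_Nil [simp]: "Poly_Mapping.lookup (prepend a c) [] = 0"
  using keys_prepend[of a c] by (auto simp flip: not_in_keys_iff_lookup_eq_zero)

lemma link_prepend [simp]: "link a (prepend b c) = (if a = b then c else 0)"
  by (rule poly_mapping_eqI) (simp add: lookup_link)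

lemma behead_prepend [simp]: "behead (prepend a c) = c"
  by (simp add: behead_def prepend_def frag_extend_frag_extend)

lemma simplicial_boundary_diff [simp]:
  "simplicial_boundary (c - d) = simplicial_boundary c - simplicial_boundary d"
  by (simp add: simplicial_boundary_def frag_extend_diff)

lemma simplicial_boundary_Nil [simp]: "simplicial_boundary (frag_of []) = 0"
  by (simp add: simplicial_boundary_def)

lemma simplicial_boundary_Cons [simp]:
  "simplicial_boundary (frag_of (a # F)) =
     frag_of F - prepend a (simplicial_boundary (frag_of F))"
proof -
  have "simplicial_boundary (frag_of (a # F)) =
      (\<Sum>i<length (a # F). frag_cmul ((-1) ^ i) (frag_of (take i (a # F) @ drop (Suc i) (a # F))))"
    unfolding simplicial_boundary_def by (rule frag_extend_of)
  also have "\<dots> =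
      frag_of F + (\<Sum>i<length F. frag_cmul (- ((-1) ^ i)) (frag_of (a # take i F @ drop (Suc i) F)))"
    unfolding length_Cons by (subst sum.lessThan_Suc_shift) simp
  also have "(\<Sum>i<length F. frag_cmul (- ((-1) ^ i)) (frag_of (a # take i F @ drop (Suc i) F))) =
      - prepend a (simplicial_boundary (frag_of F))"
    by (simp add: simplicial_boundary_def flip: sum_negf)
  finally show ?thesis by simp
qed

lemma simplicial_boundary_prepend [simp]:
  "simplicial_boundary (prepend a c) = c - prepend a (simplicial_boundary c)"
  using subset_UNIV[of "Poly_Mapping.keys c"]
  by (induction c rule: frag_induction) (simp_all add: algebra_simps)

text \<open>
  Deleting the first entry of a list gives \<open>behead\<close>; deleting a later one keeps the first entry and
  happens inside the link. The boundary equation of a cycle thus separates into one equation for each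
  link and one for \<open>behead\<close>.
\<close>

lemma link_simplicial_boundary:
  "link a (simplicial_boundary c) = link a (behead c) - simplicial_boundary (link a c)"
  using subset_UNIV[of "Poly_Mapping.keys c"]
proof (induction c rule: frag_induction)
  case (one F)
  then show ?case by (cases F) auto
next
  case (diff b c)
  show ?case by (simp add: diff.IH)
qed simp

lemma chain_decompose:
  assumes "[] \<notin> Poly_Mapping.keys c" "finite I" "hd ` Poly_Mapping.keys c \<subseteq> I"
  shows "c = (\<Sum>a\<in>I. prepend a (link a c))"
proof (rule poly_mapping_eqI)
  fix F
  show "Poly_Mapping.lookup c F = Poly_Mapping.lookup (\<Sum>a\<in>I. prepend a (link a c)) F"
  proof (cases F)
    case Nil
    then show ?thesis using assms(1) by (simp add: lookup_sum in_keys_iff)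
  next
    case (Cons b G)
    have "b \<in> I" if "Poly_Mapping.lookup c F \<noteq> 0"
      using that assms(3) Cons by (metis imageI in_keys_iff list.sel(1) subsetD)
    then show ?thesis
      using Cons assms(2) by (auto simp: lookup_sum lookup_link)
  qed
qed

lemma behead_decompose:
  assumes "[] \<notin> Poly_Mapping.keys c" "finite I" "hd ` Poly_Mapping.keys c \<subseteq> I"
  shows "behead c = (\<Sum>a\<in>I. link a c)"
proof -
  have "behead c = behead (\<Sum>a\<in>I. prepend a (link a c))"
    using chain_decompose[OF assms] by simp
  also have "\<dots> = (\<Sum>a\<in>I. link a c)"
    using assms(2) unfolding behead_def
    by (simp add: frag_extend_sum o_def behead_prepend[unfolded behead_def])
  finally show ?thesis .
qed

section \<open>Cones and suspensions of complete flags\<close>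

context finite_dimensional_vector_space
begin

text \<open>
  Flags are listed from the largest subspace down. The cone over \<open>H\<^sub>1 \<supset> \<dots> \<supset> H\<^sub>r\<close> with apex \<open>\<langle>u\<rangle>\<close> is the
  alternating sum of the flags \<open>H\<^sub>1 + \<langle>u\<rangle> \<supseteq> \<dots> \<supseteq> H\<^sub>i + \<langle>u\<rangle> \<supseteq> H\<^sub>i \<supset> \<dots> \<supset> H\<^sub>r\<close> for \<open>i = 1, \<dots>, r\<close> and of the
  flag \<open>H\<^sub>1 + \<langle>u\<rangle> \<supseteq> \<dots> \<supseteq> H\<^sub>r + \<langle>u\<rangle> \<supseteq> \<langle>u\<rangle>\<close>: the simplicial homotopy between a flag, its join with \<open>\<langle>u\<rangle>\<close>,
  and the vertex \<open>\<langle>u\<rangle>\<close>. If \<open>u\<close> lies in some \<open>H\<^sub>i\<close>, lists with repetitions occur; the identities below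
  hold for them as well.
\<close>

primrec cone_flag :: "'b \<Rightarrow> 'b set list \<Rightarrow> ('b set list \<Rightarrow>\<^sub>0 int)" where
  "cone_flag u [] = frag_of [span {u}]"
| "cone_flag u (G # F) =
     frag_of (span (insert u G) # G # F) - prepend (span (insert u G)) (cone_flag u F)"

definition cone :: "'b \<Rightarrow> ('b set list \<Rightarrow>\<^sub>0 int) \<Rightarrow> ('b set list \<Rightarrow>\<^sub>0 int)" where
  "cone u = frag_extend (cone_flag u)"

lemma cone_simps [simp]:
  "cone u 0 = 0" "cone u (frag_of F) = cone_flag u F" "cone u (c - d) = cone u c - cone u d"
  "finite I \<Longrightarrow> cone u (\<Sum>i\<in>I. e i) = (\<Sum>i\<in>I. cone u (e i))"
  by (simp_all add: cone_def frag_extend_diff frag_extend_sum o_def)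

lemma cone_prepend:
  "cone u (prepend G c) =
     prepend (span (insert u G)) (prepend G c) - prepend (span (insert u G)) (cone u c)"
  using subset_UNIV[of "Poly_Mapping.keys c"]
  by (induction c rule: frag_induction) (simp_all add: algebra_simps)

text \<open>
  The cone operator is a contracting homotopy. The computation only uses that every member \<open>G\<close> of a list
  is replaced by \<open>G + \<langle>u\<rangle>\<close>, one member at a time.
\<close>

lemma simplicial_boundary_cone:
  "simplicial_boundary (cone u c) = c - cone u (simplicial_boundary c)"
  using subset_UNIV[of "Poly_Mapping.keys c"]
proof (induction c rule: frag_induction)
  case (one F)
  show ?case
  proof (induction F)
    case (Cons G F)
    then show ?case by (simp add: cone_prepend)
  qed simp
qed (simp_all add: algebra_simps)

text \<open>
  The flag \<open>F\<close> lists proper non-zero subspaces of \<open>W\<close>, one in each dimension; \<open>W\<close> itself is omitted. The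
  last entry is a line, so the list is empty exactly if \<open>W\<close> is a line.
\<close>

primrec complete_flag :: "'b set \<Rightarrow> 'b set list \<Rightarrow> bool" where
  "complete_flag W [] \<longleftrightarrow> dim W = 1"
| "complete_flag W (H # F) \<longleftrightarrow>
     subspace H \<and> H \<subseteq> W \<and> dim W = Suc (dim H) \<and> complete_flag H F"

text \<open>
  The Steinberg module of a subspace. Having all subspaces \<open>W\<close> of one vector space at hand allows
  induction on the dimension.
\<close>

definition St :: "'b set \<Rightarrow> ('b set list \<Rightarrow>\<^sub>0 int) set" where
  "St W = {c. (\<forall>F\<in>Poly_Mapping.keys c. complete_flag W F) \<and> simplicial_boundary c = 0}"

lemma St_flag: "c \<in> St W \<Longrightarrow> F \<in> Poly_Mapping.keys c \<Longrightarrow> complete_flag W F"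
  by (simp add: St_def)

lemma St_flag_Cons:
  assumes "c \<in> St W" "H # F \<in> Poly_Mapping.keys c"
  shows "subspace H" "H \<subseteq> W" "dim W = Suc (dim H)" "complete_flag H F"
  using St_flag[OF assms] by simp_all

text \<open>
  The largest proper member of a complete flag; in a line this is \<open>{0}\<close>, which has codimension one as well.
\<close>

definition top_space :: "'b set list \<Rightarrow> 'b set" where
  "top_space F = (case F of [] \<Rightarrow> {0} | H # _ \<Rightarrow> H)"

lemma top_space_simps [simp]: "top_space [] = {0}" "top_space (H # F) = H"
  by (simp_all add: top_space_def)

definition generic :: "'b \<Rightarrow> ('b set list \<Rightarrow>\<^sub>0 int) \<Rightarrow> bool" where
  "generic v c \<longleftrightarrow> (\<forall>F\<in>Poly_Mapping.keys c. v \<notin> top_space F)"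

lemma dim_insert_subspace:
  assumes "subspace K"
  shows "dim (insert u K) = (if u \<in> K then dim K else Suc (dim K))"
  using assms by (simp add: dim_insert span_eq_iff[THEN iffD2])

lemma span_insert_eq:
  assumes "subspace K" "subspace W" "K \<subseteq> W" "dim W = Suc (dim K)" "u \<in> W" "u \<notin> K"
  shows "span (insert u K) = W"
proof (rule subspace_dim_equal)
  show "span (insert u K) \<subseteq> W" using assms by (intro span_minimal) auto
qed (use assms in \<open>simp_all add: dim_insert_subspace\<close>)

lemma complete_flag_length: "complete_flag W F \<Longrightarrow> dim W = Suc (length F)"
  by (induction F arbitrary: W) auto

lemma complete_flag_top:
  assumes "complete_flag W F" "subspace W"
  shows "subspace (top_space F)" "top_space F \<subseteq> W" "dim W = Suc (dim (top_space F))"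
  using assms by (cases F; auto simp: subspace_0 subspace_single_0)+

text \<open>
  The largest member of each flag in the cone is known exactly. This is what controls genericity
  of suspensions.
\<close>

lemma complete_flag_cone:
  assumes "complete_flag K F" "subspace K" "u \<notin> K" "E \<in> Poly_Mapping.keys (cone_flag u F)"
  shows "complete_flag (span (insert u K)) E \<and> top_space E = span (insert u (top_space F))"
  using assms
proof (induction F arbitrary: K E)
  case Nil
  then have "u \<noteq> 0" by (auto simp: subspace_0)
  then show ?case
    using Nil span_mono[of "{u}" "insert u K"] span_insert_0[of "{u}"]
    by (simp add: dim_insert_subspace insert_commute)
next
  case (Cons G F)
  let ?X = "span (insert u G)"
  have G: "subspace G" "G \<subseteq> K" "dim K = Suc (dim G)" "complete_flag G F" "u \<notin> G"
    using Cons.prems by auto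
  have X: "?X \<subseteq> span (insert u K)" "dim (span (insert u K)) = Suc (dim ?X)" "dim ?X = Suc (dim G)"
    using G Cons.prems by (auto simp: dim_insert_subspace intro!: span_mono)
  have "E = ?X # G # F \<or> E \<in> Poly_Mapping.keys (prepend ?X (cone_flag u F))"
    using Cons.prems(4) keys_diff[of "frag_of (?X # G # F)"] by auto
  then consider "E = ?X # G # F" | E' where "E = ?X # E'" "E' \<in> Poly_Mapping.keys (cone_flag u F)"
    using keys_prepend[of ?X "cone_flag u F"] by blast
  then show ?case
  proof cases
    case 1
    have "G \<subseteq> ?X" using span_superset[of "insert u G"] by auto
    then show ?thesis using 1 G X by simp
  next
    case 2
    then show ?thesis using Cons.IH[OF G(4,1,5) 2(2)] X by simp
  qed
qed

text \<open>
  Both \<open>prepend K c\<close> and \<open>cone u c\<close> have boundary \<open>c\<close> for a cycle \<open>c\<close> of \<open>K\<close>, so gluing the two cones along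
  \<open>c\<close> gives a cycle of \<open>K \<oplus> \<langle>u\<rangle>\<close>.
\<close>

definition suspension :: "'b \<Rightarrow> 'b set \<Rightarrow> ('b set list \<Rightarrow>\<^sub>0 int) \<Rightarrow> ('b set list \<Rightarrow>\<^sub>0 int)" where
  "suspension u K c = prepend K c - cone u c"

lemma suspension_simps [simp]:
  "suspension u K 0 = 0" "suspension u K (c - d) = suspension u K c - suspension u K d"
  by (simp_all add: suspension_def)

lemma keys_suspension:
  assumes "E \<in> Poly_Mapping.keys (suspension u K c)"
  obtains F where "F \<in> Poly_Mapping.keys c" "E = K # F"
  | F where "F \<in> Poly_Mapping.keys c" "E \<in> Poly_Mapping.keys (cone_flag u F)"
proof -
  have "E \<in> Poly_Mapping.keys (prepend K c) \<or> E \<in> Poly_Mapping.keys (cone u c)"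
    using assms keys_diff[of "prepend K c" "cone u c"] by (auto simp: suspension_def)
  then show ?thesis
  proof
    assume "E \<in> Poly_Mapping.keys (prepend K c)"
    then show ?thesis using keys_prepend[of K c] that(1) by blast
  next
    assume "E \<in> Poly_Mapping.keys (cone u c)"
    then show ?thesis unfolding cone_def by (rule keys_frag_extend_in) (rule that(2))
  qed
qed

lemma suspension_in_St:
  assumes K: "subspace K" "u \<notin> K" and c: "c \<in> St K"
  shows "suspension u K c \<in> St (span (insert u K))"
proof -
  have "complete_flag (span (insert u K)) E" if "E \<in> Poly_Mapping.keys (suspension u K c)" for E
    using that
  proof (cases rule: keys_suspension)
    case (1 F)
    have "K \<subseteq> span (insert u K)" using span_superset[of "insert u K"] by auto
    then show ?thesis using 1 K c by (simp add: St_def dim_insert_subspace)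
  next
    case (2 F)
    then show ?thesis using complete_flag_cone[of K F u E] K c by (auto simp: St_def)
  qed
  moreover have "simplicial_boundary (suspension u K c) = 0"
    using c by (simp add: suspension_def simplicial_boundary_cone St_def)
  ultimately show ?thesis by (simp add: St_def)
qed

lemma generic_suspension:
  assumes K: "subspace K" "w \<notin> K" and c: "c \<in> St K"
    and gen: "\<And>F. F \<in> Poly_Mapping.keys c \<Longrightarrow> w \<notin> span (insert u (top_space F))"
    and u: "u \<notin> K"
  shows "generic w (suspension u K c)"
  unfolding generic_def
proof
  fix E assume "E \<in> Poly_Mapping.keys (suspension u K c)"
  then show "w \<notin> top_space E"
  proof (cases rule: keys_suspension)
    case 1
    then show ?thesis using K by simp
  next
    case (2 F)
    then show ?thesis using complete_flag_cone[of K F u E] K u c gen by (auto simp: St_def)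
  qed
qed

text \<open>
  The largest members of the flags in the suspension are \<open>K\<close> and the sums \<open>T + \<langle>u\<rangle>\<close> with \<open>T\<close> a largest
  member of a flag in \<open>c\<close>. Since \<open>u \<notin> K\<close>, neither \<open>K\<close> nor such a sum contains \<open>u + k\<close> unless \<open>k \<in> T\<close>.
\<close>

lemma generic_suspension_sum:
  assumes K: "subspace K" and c: "c \<in> St K" and gen: "generic k c" and k: "k \<in> K"
    and u: "u \<notin> K"
  shows "generic (u + k) (suspension u K c)"
proof (rule generic_suspension[OF K _ c _ u])
  show "u + k \<notin> K" using K k u by (metis add_diff_cancel subspace_diff)
  fix F assume F: "F \<in> Poly_Mapping.keys c"
  let ?T = "top_space F"
  have T: "subspace ?T" "?T \<subseteq> K" using complete_flag_top[of K F] F c K by (auto simp: St_def)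
  show "u + k \<notin> span (insert u ?T)"
  proof
    assume "u + k \<in> span (insert u ?T)"
    then have "k \<in> span (insert u ?T)"
      by (metis add_diff_cancel_left' insertI1 span_base span_diff)
    then obtain a where a: "k - scale a u \<in> ?T"
      using T(1) by (auto simp: span_insert span_eq_iff[THEN iffD2])
    have "k \<notin> ?T" using gen F by (auto simp: generic_def)
    with a have "a \<noteq> 0" by auto
    have "scale a u \<in> K" using a T(2) K k by (metis diff_diff_eq2 add_diff_cancel_left' subsetD subspace_diff)
    then have "scale (inverse a) (scale a u) \<in> K" using K subspace_scale by blast
    with \<open>a \<noteq> 0\<close> u show False by simp
  qed
qed

lemma St_nonempty:
  assumes "c \<in> St W" "dim W \<noteq> 1"
  shows "[] \<notin> Poly_Mapping.keys c"
  using assms by (auto simp: St_def)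

lemma St_top:
  assumes "c \<in> St W" "dim W \<noteq> 1" "H \<in> hd ` Poly_Mapping.keys c"
  shows "subspace H" "H \<subseteq> W" "dim W = Suc (dim H)"
proof -
  obtain F where F: "F \<in> Poly_Mapping.keys c" "H = hd F" using assms(3) by blast
  then obtain E where "F = H # E"
    using St_nonempty[OF assms(1,2)] by (cases F) auto
  then show "subspace H" "H \<subseteq> W" "dim W = Suc (dim H)"
    using St_flag_Cons[OF assms(1)] F(1) by blast+
qed

text \<open>
  In the boundary equation the terms beginning with \<open>H\<close>, of codimension one, cannot cancel
  against terms that begin with a subspace of codimension two.
\<close>

lemma link_in_St:
  assumes c: "c \<in> St W"
  shows "link H c \<in> St H"
proof (cases "link H c = 0")
  case True
  then show ?thesis by (simp add: St_def)
next
  case False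
  then obtain F where "F \<in> Poly_Mapping.keys (link H c)" by (metis keys_eq_empty ex_in_conv)
  then have dimH: "dim W = Suc (dim H)" using St_flag_Cons(3)[OF c] by (simp add: keys_link)
  have "link H (behead c) = 0"
  proof (rule ccontr)
    assume "link H (behead c) \<noteq> 0"
    then obtain F where "F \<in> Poly_Mapping.keys (link H (behead c))" by (metis keys_eq_empty ex_in_conv)
    then have "H # F \<in> Poly_Mapping.keys (behead c)" by (simp add: keys_link)
    then obtain E where "E \<in> Poly_Mapping.keys c" "H # F \<in> Poly_Mapping.keys (case E of [] \<Rightarrow> 0 | b # G \<Rightarrow> frag_of G)"
      unfolding behead_def by (rule keys_frag_extend_in)
    then obtain G where "G # H # F \<in> Poly_Mapping.keys c"
      by (cases E) auto
    from St_flag_Cons(3,4)[OF c this] have "dim W = Suc (dim G)" "dim G = Suc (dim H)"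
      by simp_all
    then show False using dimH by linarith
  qed
  then have "simplicial_boundary (link H c) = 0"
    using link_simplicial_boundary[of H c] c by (simp add: St_def)
  moreover have "complete_flag H F" if "F \<in> Poly_Mapping.keys (link H c)" for F
    using St_flag_Cons(4)[OF c] that by (simp add: keys_link)
  ultimately show ?thesis by (simp add: St_def)
qed

lemma behead_St:
  assumes c: "c \<in> St W" and W: "dim W \<noteq> 1"
  shows "behead c = 0"
proof -
  let ?I = "hd ` Poly_Mapping.keys c"
  note ne = St_nonempty[OF c W]
  have "0 = simplicial_boundary (\<Sum>H\<in>?I. prepend H (link H c))"
    using c chain_decompose[OF ne finite_imageI[OF finite_keys] order_refl] by (simp add: St_def)
  also have "\<dots> = (\<Sum>H\<in>?I. simplicial_boundary (prepend H (link H c)))"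
    by (simp add: simplicial_boundary_def frag_extend_sum o_def)
  also have "\<dots> = (\<Sum>H\<in>?I. link H c)"
    using link_in_St[OF c] by (simp add: St_def)
  also have "\<dots> = behead c"
    using behead_decompose[OF ne finite_imageI[OF finite_keys] order_refl] by simp
  finally show ?thesis by simp
qed

text \<open>
  The cones over the links add up to the cone over \<open>behead c = 0\<close>, so subtracting them changes nothing.
\<close>

lemma St_eq_sum:
  assumes c: "c \<in> St W" and W: "dim W \<noteq> 1"
  shows "c = (\<Sum>H\<in>hd ` Poly_Mapping.keys c. suspension v H (link H c))"
proof -
  let ?I = "hd ` Poly_Mapping.keys c"
  note ne = St_nonempty[OF c W]
  have "(\<Sum>H\<in>?I. cone v (link H c)) = cone v (behead c)"
    using behead_decompose[OF ne finite_imageI[OF finite_keys] order_refl] by simp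
  then show ?thesis
    using chain_decompose[OF ne finite_imageI[OF finite_keys] order_refl] behead_St[OF c W]
    by (simp add: suspension_def sum_subtractf)
qed

text \<open>
  For \<open>v\<close> in \<open>W\<close> the cone consists of degenerate lists and of lists starting with \<open>W\<close>. By induction, the
  degenerate parts coming from hyperplanes \<open>H\<close> that contain \<open>v\<close> cancel, and what is left is the cone
  with apex \<open>W\<close>. Equivalently, \<open>suspension v W c = 0\<close>.
\<close>

lemma cone_St:
  assumes "c \<in> St W" "subspace W" "v \<in> W" "v \<noteq> 0"
  shows "cone v c = prepend W c"
  using assms
proof (induction "dim W" arbitrary: W c rule: less_induct)
  case less
  show ?case
  proof (cases "dim W = 1")
    case True
    have "span {v} = W"
      using less.prems True span_minimal[of "{v}" W] by (intro subspace_dim_equal) auto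
    have "cone_flag v F = frag_of (W # F)" if "F \<in> Poly_Mapping.keys c" for F
      using complete_flag_length[OF St_flag[OF less.prems(1) that]] True \<open>span {v} = W\<close> by simp
    then show ?thesis
      unfolding cone_def prepend_def by (rule frag_extend_eq)
  next
    case False
    let ?I = "hd ` Poly_Mapping.keys c"
    note c = less.prems(1)
    note top = St_top[OF c False] and ne = St_nonempty[OF c False]
    have "cone v (prepend H (link H c)) = prepend W (suspension v H (link H c))" if H: "H \<in> ?I" for H
    proof (cases "v \<in> H")
      case True
      have "cone v (link H c) = prepend H (link H c)"
        using top[OF H] True less.prems(4) by (intro less.hyps link_in_St[OF c]) auto
      then show ?thesis by (simp add: cone_prepend suspension_def)
    next
      case False
      then have "span (insert v H) = W"
        using top[OF H] less.prems by (intro span_insert_eq) auto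
      then show ?thesis by (simp add: cone_prepend suspension_def)
    qed
    then have "(\<Sum>H\<in>?I. cone v (prepend H (link H c))) =
        prepend W (\<Sum>H\<in>?I. suspension v H (link H c))"
      by simp
    moreover have "cone v c = (\<Sum>H\<in>?I. cone v (prepend H (link H c)))"
      using arg_cong[OF chain_decompose[OF ne finite_imageI[OF finite_keys] order_refl], of "cone v"]
      by simp
    ultimately show ?thesis using St_eq_sum[OF c False, of v] by simp
  qed
qed

text \<open>
  The hyperplanes that contain \<open>v\<close> contribute nothing to the sum of all suspensions, by \<open>cone_St\<close>.
\<close>

lemma St_line_decomposition:
  assumes c: "c \<in> St W" and W: "dim W \<noteq> 1" and v: "v \<noteq> 0"
  shows "c = (\<Sum>H | H \<in> hd ` Poly_Mapping.keys c \<and> v \<notin> H. suspension v H (link H c))"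
proof -
  have "suspension v H (link H c) = 0" if "H \<in> hd ` Poly_Mapping.keys c" "v \<in> H" for H
    using cone_St[OF link_in_St[OF c, of H] _ that(2) v] St_top[OF c W that(1)]
    by (simp add: suspension_def)
  then have "(\<Sum>H\<in>hd ` Poly_Mapping.keys c. suspension v H (link H c)) =
      (\<Sum>H | H \<in> hd ` Poly_Mapping.keys c \<and> v \<notin> H. suspension v H (link H c))"
    by (intro sum.mono_neutral_right) auto
  then show ?thesis using St_eq_sum[OF c W, of v] by simp
qed

end

section \<open>Projection to a hyperplane\<close>

context finite_dimensional_vector_space
begin

lemma dim_Int_hyperplane:
  assumes W: "subspace W" "W \<subseteq> span (insert w K)" "\<not> W \<subseteq> K" and K: "subspace K"
  shows "dim W = Suc (dim (W \<inter> K))"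
proof -
  obtain u where u: "u \<in> W" "u \<notin> K" using W by blast
  have "W \<subseteq> span (insert u (W \<inter> K))"
  proof
    fix x assume x: "x \<in> W"
    obtain a where a: "x - scale a w \<in> K"
      using x W(2) K by (auto simp: span_insert span_eq_iff[THEN iffD2])
    obtain b where b: "u - scale b w \<in> K"
      using u W(2) K by (auto simp: span_insert span_eq_iff[THEN iffD2])
    have "b \<noteq> 0" using b u by auto
    let ?c = "a / b"
    have "(x - scale a w) - scale ?c (u - scale b w) \<in> K"
      by (rule subspace_diff[OF K a subspace_scale[OF K b]])
    also have "(x - scale a w) - scale ?c (u - scale b w) = x - scale ?c u"
      using \<open>b \<noteq> 0\<close> by (simp add: algebra_simps)
    finally have "x - scale ?c u \<in> W \<inter> K"
      using x u W(1) by (simp add: subspace_diff subspace_scale)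
    then show "x \<in> span (insert u (W \<inter> K))"
      unfolding span_insert using span_base by blast
  qed
  moreover have "span (insert u (W \<inter> K)) \<subseteq> W"
    using u W(1) by (intro span_minimal) auto
  ultimately have "dim W = dim (insert u (W \<inter> K))"
    by (metis dim_span subset_antisym)
  then show ?thesis
    using u W(1) K by (simp add: dim_insert_subspace subspace_inter)
qed

lemma span_insert_Int_hyperplane:
  assumes "subspace W" "W \<subseteq> span (insert w K)" "subspace K" "u \<in> W" "u \<notin> K"
  shows "span (insert u (W \<inter> K)) = W"
proof (rule span_insert_eq)
  show "dim W = Suc (dim (W \<inter> K))"
    using assms by (intro dim_Int_hyperplane[where w = w]) auto
qed (use assms in \<open>auto simp: subspace_inter\<close>)

text \<open>
  For a hyperplane \<open>K\<close> and a line \<open>l\<close> outside it, the flags whose smallest member is \<open>l\<close> correspond to the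
  flags of \<open>K\<close>, by intersecting the other members with \<open>K\<close>. All other flags are sent to \<open>0\<close>.
\<close>

primrec project_flag :: "'b set \<Rightarrow> 'b set \<Rightarrow> 'b set list \<Rightarrow> ('b set list \<Rightarrow>\<^sub>0 int)" where
  "project_flag K l [] = 0"
| "project_flag K l (H # F) =
     (if H = l then (if F = [] then frag_of [] else 0) else prepend (H \<inter> K) (project_flag K l F))"

definition project :: "'b set \<Rightarrow> 'b set \<Rightarrow> ('b set list \<Rightarrow>\<^sub>0 int) \<Rightarrow> ('b set list \<Rightarrow>\<^sub>0 int)" where
  "project K l = frag_extend (project_flag K l)"

lemma project_simps [simp]:
  "project K l 0 = 0" "project K l (frag_of F) = project_flag K l F"
  "project K l (c - d) = project K l c - project K l d"
  "project K l (frag_cmul k c) = frag_cmul k (project K l c)"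
  "finite I \<Longrightarrow> project K l (\<Sum>i\<in>I. e i) = (\<Sum>i\<in>I. project K l (e i))"
  by (simp_all add: project_def frag_extend_diff frag_extend_cmul frag_extend_sum o_def)

lemma project_prepend:
  assumes "H \<noteq> l"
  shows "project K l (prepend H c) = prepend (H \<inter> K) (project K l c)"
  using subset_UNIV[of "Poly_Mapping.keys c"]
  by (induction c rule: frag_induction) (simp_all add: assms)

lemma complete_flag_last:
  assumes "complete_flag W F" "F \<noteq> []"
  shows "last F \<subseteq> top_space F" "top_space F \<subseteq> W" "subspace (last F)" "dim (last F) = 1"
proof -
  have "last F \<subseteq> top_space F \<and> top_space F \<subseteq> W \<and> subspace (last F) \<and> dim (last F) = 1"
    using assms
  proof (induction F arbitrary: W)
    case (Cons H F)
    then show ?case by (cases "F = []") fastforce+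
  qed simp
  then show "last F \<subseteq> top_space F" "top_space F \<subseteq> W" "subspace (last F)" "dim (last F) = 1"
    by auto
qed

lemma project_flag_eq_0:
  assumes "complete_flag W F" "\<not> (F \<noteq> [] \<and> last F = l)"
  shows "project_flag K l F = 0"
  using assms
proof (induction F arbitrary: W)
  case (Cons H F)
  then show ?case by (cases "F = []") auto
qed simp

lemma complete_flag_project:
  assumes "complete_flag W F" "subspace W" "W \<subseteq> span (insert w K)" "subspace K"
    "u \<notin> K" "E \<in> Poly_Mapping.keys (project_flag K (span {u}) F)"
  shows "complete_flag (W \<inter> K) E \<and> u \<in> top_space F \<and> top_space E \<subseteq> top_space F"
  using assms
proof (induction F arbitrary: W E)
  case (Cons H F)
  have H: "subspace H" "H \<subseteq> W" "dim W = Suc (dim H)" "complete_flag H F"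
    using Cons.prems by auto
  have last: "last (H # F) = span {u}"
    using project_flag_eq_0[OF Cons.prems(1)] Cons.prems(6) by fastforce
  then have u: "u \<in> H"
    using complete_flag_last(1)[OF Cons.prems(1)] span_base[of u "{u}"] by auto
  then have "\<not> H \<subseteq> K" "\<not> W \<subseteq> K" using H \<open>u \<notin> K\<close> by auto
  then have dims: "dim H = Suc (dim (H \<inter> K))" "dim W = Suc (dim (W \<inter> K))"
    using dim_Int_hyperplane[of H w K] dim_Int_hyperplane[of W w K] H Cons.prems by auto
  show ?case
  proof (cases "H = span {u}")
    case True
    then have "E = []" using Cons.prems(6) by (auto split: if_splits)
    moreover have "u \<noteq> 0" using \<open>u \<notin> K\<close> \<open>subspace K\<close> by (auto simp: subspace_0)
    ultimately show ?thesis
      using True dims H u by (simp add: subspace_0)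
  next
    case False
    then have "E \<in> Poly_Mapping.keys (prepend (H \<inter> K) (project_flag K (span {u}) F))"
      using Cons.prems(6) by simp
    then obtain E' where E': "E = (H \<inter> K) # E'" "E' \<in> Poly_Mapping.keys (project_flag K (span {u}) F)"
      using keys_prepend[of "H \<inter> K" "project_flag K (span {u}) F"] by blast
    have "complete_flag (H \<inter> K) E'"
      using Cons.IH[OF H(4,1) _ Cons.prems(4,5) E'(2)] H(2) Cons.prems(3) by auto
    then show ?thesis
      using E'(1) dims H u Cons.prems(4) by (auto simp: subspace_inter)
  qed
qed simp

text \<open>
  Deleting the smallest member of a complete flag leaves a list that does not end in a line, so it
  is sent to \<open>0\<close>; the other faces are treated alike on both sides.
\<close>

lemma simplicial_boundary_project_flag:
  assumes "complete_flag W F" "F \<noteq> []" "dim l = 1"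
  shows "simplicial_boundary (project_flag K l F) = project K l (simplicial_boundary (frag_of F))"
  using assms
proof (induction F arbitrary: W)
  case (Cons H F)
  show ?case
  proof (cases "F = []")
    case False
    then obtain G E where "F = G # E" by (cases F) auto
    moreover have "complete_flag H F" using Cons.prems by simp
    ultimately have "H \<noteq> l" using complete_flag_length[of H F] Cons.prems(3) by auto
    then show ?thesis using Cons.IH[of H] Cons.prems False by (simp add: project_prepend)
  qed simp
qed simp

lemma project_in_St:
  assumes c: "c \<in> St W" and W: "dim W \<noteq> 1" "subspace W" "W \<subseteq> span (insert w K)"
    and K: "subspace K" and u: "u \<notin> K"
  shows "project K (span {u}) c \<in> St (W \<inter> K)"
proof -
  have "u \<noteq> 0" using u K by (auto simp: subspace_0)
  then have 1: "dim (span {u}) = 1" by simp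
  have "complete_flag (W \<inter> K) E" if "E \<in> Poly_Mapping.keys (project K (span {u}) c)" for E
    using that unfolding project_def
  proof (rule keys_frag_extend_in)
    fix F assume "F \<in> Poly_Mapping.keys c" "E \<in> Poly_Mapping.keys (project_flag K (span {u}) F)"
    then show ?thesis using complete_flag_project[OF St_flag[OF c] W(2,3) K u] by blast
  qed
  moreover have "simplicial_boundary (project K (span {u}) c) =
      frag_extend (\<lambda>F. simplicial_boundary (project_flag K (span {u}) F)) c"
    by (simp add: simplicial_boundary_def project_def frag_extend_frag_extend)
  moreover have "\<dots> = frag_extend (\<lambda>F. project K (span {u}) (simplicial_boundary (frag_of F))) c"
  proof (rule frag_extend_eq)
    fix F assume F: "F \<in> Poly_Mapping.keys c"
    then have "F \<noteq> []" using St_nonempty[OF c W(1)] by blast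
    then show "simplicial_boundary (project_flag K (span {u}) F) =
        project K (span {u}) (simplicial_boundary (frag_of F))"
      using simplicial_boundary_project_flag[OF St_flag[OF c F] _ 1] by blast
  qed
  moreover have "\<dots> = project K (span {u}) (simplicial_boundary c)"
    by (simp add: simplicial_boundary_def project_def frag_extend_frag_extend)
  ultimately show ?thesis using c by (simp add: St_def)
qed

lemma project_hyperplane:
  assumes c: "c \<in> St K" and u: "u \<notin> K"
  shows "project K (span {u}) c = 0"
  unfolding project_def
proof (rule frag_extend_eq_0)
  fix F assume "F \<in> Poly_Mapping.keys c"
  then have F: "complete_flag K F" using St_flag[OF c] by blast
  have "last F \<noteq> span {u}" if "F \<noteq> []"
    using complete_flag_last(1,2)[OF F that] u span_base[of u "{u}"] by auto
  then show "project_flag K (span {u}) F = 0" by (intro project_flag_eq_0[OF F]) auto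
qed

lemma project_cone_flag:
  assumes F: "complete_flag K' F" and K: "subspace K" "K' \<subseteq> K" "subspace K'"
    and u: "u \<notin> K" and u': "u' \<notin> K"
  shows "project K (span {u'}) (cone_flag u F) =
    (if span {u'} = span {u} then frag_cmul ((-1) ^ length F) (frag_of F) else 0)"
  using F K(2,3)
proof (induction F arbitrary: K')
  case (Cons G F)
  let ?X = "span (insert u G)"
  have G: "subspace G" "G \<subseteq> K" "complete_flag G F" "complete_flag K' (G # F)"
    using Cons.prems by auto
  have X: "dim ?X = Suc (dim G)" using G u by (auto simp: dim_insert_subspace)
  have "u \<in> ?X" "G \<subseteq> ?X" using span_superset[of "insert u G"] by auto
  have "?X \<inter> K = G"
  proof (rule subspace_dim_equal[symmetric])
    have "?X \<subseteq> span (insert u K)" using G by (intro span_mono) auto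
    then have "dim ?X = Suc (dim (?X \<inter> K))"
      using K(1) u \<open>u \<in> ?X\<close> by (intro dim_Int_hyperplane[where w = u]) auto
    then show "dim (?X \<inter> K) \<le> dim G" using X by linarith
  qed (use G K \<open>G \<subseteq> ?X\<close> in \<open>auto simp: subspace_inter\<close>)
  have "u' \<noteq> 0" using u' K(1) by (auto simp: subspace_0)
  moreover have "dim G \<noteq> 0" using complete_flag_length[OF G(3)] by simp
  ultimately have ne: "?X \<noteq> span {u'}" using X by (metis One_nat_def dim_singleton dim_span nat.inject)
  have "last (G # F) \<noteq> span {u'}"
    using complete_flag_last(1)[OF G(4)] G(2) u' span_base[of u' "{u'}"] by auto
  then have "project_flag K (span {u'}) (G # F) = 0"
    by (intro project_flag_eq_0[OF G(4)]) auto
  then have "project K (span {u'}) (cone_flag u (G # F)) =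
      - prepend G (project K (span {u'}) (cone_flag u F))"
    using ne by (simp add: project_prepend \<open>?X \<inter> K = G\<close> del: project_flag.simps(2))
       (simp add: ne)
  then show ?case using Cons.IH[OF G(3,2,1)] by simp
qed auto

text \<open>
  Among the flags of a suspension only those that contain the apex line \<open>\<langle>u\<rangle>\<close> end in a line outside \<open>K\<close>, and they
  project back to the flags of \<open>c\<close>. The sign is that of the last term of the cone.
\<close>

lemma project_suspension:
  assumes c: "c \<in> St K" and K: "subspace K" and u: "u \<notin> K" and u': "u' \<notin> K"
  shows "project K (span {u'}) (suspension u K c) =
    (if span {u'} = span {u} then frag_cmul ((-1) ^ dim K) c else 0)"
proof -
  have "project K (span {u'}) (cone u c) =
      frag_extend (\<lambda>F. project K (span {u'}) (cone_flag u F)) c"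
    by (simp add: project_def cone_def frag_extend_frag_extend)
  also have "\<dots> = frag_extend (\<lambda>F. frag_cmul
      (if span {u'} = span {u} then - ((-1) ^ dim K) else 0) (frag_of F)) c"
  proof (rule frag_extend_eq)
    fix F assume "F \<in> Poly_Mapping.keys c"
    then have F: "complete_flag K F" by (rule St_flag[OF c])
    show "project K (span {u'}) (cone_flag u F) = frag_cmul
      (if span {u'} = span {u} then - ((-1) ^ dim K) else 0) (frag_of F)"
      using project_cone_flag[OF F K order_refl K u u'] complete_flag_length[OF F] by simp
  qed
  also have "\<dots> = frag_cmul (if span {u'} = span {u} then - ((-1) ^ dim K) else 0) c"
    by (simp only: frag_extend_cmul_fun frag_extend_frag_of)
  finally have "project K (span {u'}) (cone u c) = \<dots>" .
  moreover have "K \<noteq> span {u'}" using u' span_base[of u' "{u'}"] by auto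
  ultimately show ?thesis
    using project_hyperplane[OF c u'] by (simp add: suspension_def project_prepend)
qed

text \<open>
  By induction the link of each \<open>H\<close> not contained in \<open>K\<close> vanishes, so \<open>W \<inter> K\<close> is the only possible
  first entry; but then \<open>behead\<close> is injective on the cycle and sends it to \<open>0\<close>.
\<close>

lemma St_eq_0:
  assumes "c \<in> St W" "subspace W" "W \<subseteq> span (insert w K)" "subspace K" "\<not> W \<subseteq> K"
    and "\<And>F. F \<in> Poly_Mapping.keys c \<Longrightarrow> last (W # F) \<subseteq> K"
  shows "c = 0"
  using assms
proof (induction "dim W" arbitrary: W c rule: less_induct)
  case less
  note c = less.prems(1)
  show ?case
  proof (cases "dim W = 1")
    case True
    have "F \<notin> Poly_Mapping.keys c" for F
      using complete_flag_length[OF St_flag[OF c], of F] True less.prems(5) less.prems(6)[of F] by auto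
    then show ?thesis by (metis keys_eq_empty ex_in_conv)
  next
    case False
    let ?H = "W \<inter> K"
    have "H = ?H" if HF: "H # F \<in> Poly_Mapping.keys c" for H F
    proof -
      note H = St_flag_Cons[OF c HF]
      have "H \<subseteq> K"
      proof (rule ccontr)
        assume "\<not> H \<subseteq> K"
        moreover have "last (H # E) \<subseteq> K" if "E \<in> Poly_Mapping.keys (link H c)" for E
          using less.prems(6)[of "H # E"] that by (simp add: keys_link)
        moreover have "dim H < dim W" "H \<subseteq> span (insert w K)"
          using H less.prems(3) by auto
        ultimately have "link H c = 0"
          using less.hyps[OF _ link_in_St[OF c] H(1) _ less.prems(4)] by blast
        then show False using HF by (metis keys_link keys_zero empty_iff)
      qed
      then show ?thesis
        using H dim_Int_hyperplane[OF less.prems(2,3,5,4)] less.prems(2,4)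
        by (intro subspace_dim_equal) (auto simp: subspace_inter)
    qed
    note head = this
    have ne: "[] \<notin> Poly_Mapping.keys c" by (rule St_nonempty[OF c False])
    have I: "hd ` Poly_Mapping.keys c \<subseteq> {?H}"
    proof (rule image_subsetI)
      fix F assume F: "F \<in> Poly_Mapping.keys c"
      then obtain H E where "F = H # E" using ne by (cases F) auto
      then show "hd F \<in> {?H}" using head[of H E] F by simp
    qed
    have "link ?H c = behead c" using behead_decompose[OF ne _ I] by simp
    also have "\<dots> = 0" by (rule behead_St[OF c False])
    finally show ?thesis using chain_decompose[OF ne _ I] by simp
  qed
qed

text \<open>
  A left inverse of the projection, on the flags that end in \<open>\<langle>u\<rangle>\<close>.
\<close>

definition lift :: "'b \<Rightarrow> ('b set list \<Rightarrow>\<^sub>0 int) \<Rightarrow> ('b set list \<Rightarrow>\<^sub>0 int)" where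
  "lift u = frag_extend (\<lambda>F. frag_of (map (\<lambda>X. span (insert u X)) F @ [span {u}]))"

lemma lift_prepend: "lift u (prepend X c) = prepend (span (insert u X)) (lift u c)"
  by (simp add: lift_def prepend_def frag_extend_frag_extend)

lemma lift_project_flag:
  assumes "complete_flag W F" "W \<subseteq> span (insert w K)" "subspace K" "u \<notin> K"
  shows "lift u (project_flag K (span {u}) F) =
    (if F \<noteq> [] \<and> last F = span {u} then frag_of F else 0)"
  using assms
proof (induction F arbitrary: W)
  case (Cons H F)
  show ?case
  proof (cases "F = []")
    case True
    then show ?thesis by (simp add: lift_def lift_prepend)
  next
    case False
    then obtain G E where F: "F = G # E" by (cases F) auto
    have H: "subspace H" "H \<subseteq> W" "complete_flag H F" using Cons.prems by auto
    have "u \<noteq> 0" using Cons.prems by (auto simp: subspace_0)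
    moreover have "dim H \<noteq> 1" using F complete_flag_length[OF H(3)] by simp
    ultimately have "H \<noteq> span {u}" by (metis dim_singleton dim_span)
    moreover have "span (insert u (H \<inter> K)) = H" if "last F = span {u}"
      using complete_flag_last(1,2)[OF H(3) False] that H Cons.prems span_base[of u "{u}"]
      by (intro span_insert_Int_hyperplane[where w = w]) auto
    ultimately show ?thesis
      using Cons.IH[OF H(3)] H Cons.prems False by (auto simp: lift_prepend)
  qed
qed (simp add: lift_def)

lemma last_neq_if_project_eq_0:
  assumes c: "c \<in> St W" and W: "W \<subseteq> span (insert w K)" "subspace K" "u \<notin> K"
    and "project K (span {u}) c = 0" "F \<in> Poly_Mapping.keys c" "F \<noteq> []"
  shows "last F \<noteq> span {u}"
proof -
  have "0 = lift u (project K (span {u}) c)" using assms(5) by (simp add: lift_def)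
  also have "\<dots> = frag_extend (\<lambda>F. lift u (project_flag K (span {u}) F)) c"
    by (simp add: lift_def project_def frag_extend_frag_extend)
  also have "\<dots> = frag_extend (\<lambda>F. if F \<noteq> [] \<and> last F = span {u} then frag_of F else 0) c"
    by (intro frag_extend_eq lift_project_flag[OF St_flag[OF c] W])
  finally have "(if F \<noteq> [] \<and> last F = span {u} then Poly_Mapping.lookup c F else 0) =
      Poly_Mapping.lookup 0 F"
    using lookup_frag_extend_restrict[of "\<lambda>F. F \<noteq> [] \<and> last F = span {u}" c F]
    by simp
  note lookup = this
  show ?thesis
  proof
    assume "last F = span {u}"
    then have "Poly_Mapping.lookup c F = 0" using lookup assms(7) by simp
    then show False using assms(6) by (simp add: in_keys_iff)
  qed
qed

end

section \<open>Subgroups and biadditive maps modulo a subgroup\<close>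

definition add_subgroup :: "'a::ab_group_add set \<Rightarrow> bool" where
  "add_subgroup X \<longleftrightarrow> 0 \<in> X \<and> (\<forall>a\<in>X. \<forall>b\<in>X. a - b \<in> X)"

lemma add_subgroup_zero: "add_subgroup X \<Longrightarrow> 0 \<in> X"
  by (simp add: add_subgroup_def)

lemma add_subgroup_diff: "add_subgroup X \<Longrightarrow> a \<in> X \<Longrightarrow> b \<in> X \<Longrightarrow> a - b \<in> X"
  by (simp add: add_subgroup_def)

lemma add_subgroup_uminus: "add_subgroup X \<Longrightarrow> a \<in> X \<Longrightarrow> - a \<in> X"
  using add_subgroup_diff[of X 0 a] by (simp add: add_subgroup_zero)

lemma add_subgroup_add: "add_subgroup X \<Longrightarrow> a \<in> X \<Longrightarrow> b \<in> X \<Longrightarrow> a + b \<in> X"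
  using add_subgroup_diff[of X a "- b"] by (simp add: add_subgroup_uminus)

lemma add_subgroup_sum:
  assumes "add_subgroup X" "\<And>i. i \<in> I \<Longrightarrow> f i \<in> X"
  shows "(\<Sum>i\<in>I. f i) \<in> X"
  using assms(2)
  by (induction I rule: infinite_finite_induct) (auto intro: add_subgroup_zero add_subgroup_add assms(1))

lemma add_subgroup_cmul:
  assumes "add_subgroup X" "c \<in> X"
  shows "frag_cmul k c \<in> X"
  using frag_closure_minus_cmul[of "\<lambda>c. c \<in> X"] assms
    by (simp add: add_subgroup_zero add_subgroup_diff)

text \<open>
  The coinvariants are a quotient that depends on the vector space, not just on its type. Forms therefore take their
  values in a fixed free abelian group, and all identities between the values are required only modulo a subgroup \<open>R\<close>.
  Additivity is stated with differences, which makes the solution sets of linear conditions subgroups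
  at once.
\<close>

definition biadditive_mod ::
    "'z::ab_group_add set \<Rightarrow> 'a::ab_group_add set \<Rightarrow> ('a \<Rightarrow> 'a \<Rightarrow> 'z) \<Rightarrow> bool" where
  "biadditive_mod R M b \<longleftrightarrow>
     (\<forall>x\<in>M. \<forall>x'\<in>M. \<forall>y\<in>M. b (x - x') y - (b x y - b x' y) \<in> R) \<and>
     (\<forall>x\<in>M. \<forall>y\<in>M. \<forall>y'\<in>M. b x (y - y') - (b x y - b x y') \<in> R)"

lemma biadditive_mod_swap: "biadditive_mod R M b \<Longrightarrow> biadditive_mod R M (\<lambda>x y. b y x)"
  by (auto simp: biadditive_mod_def)

text \<open>
  With this, the equation \<open>b x y = \<langle>x, y\<rangle> m\<close> needs to be checked on generators only.
\<close>

lemma multiple_of_pairing_left: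
  assumes R: "add_subgroup R" and M: "add_subgroup M" and b: "biadditive_mod R M b" and y: "y \<in> M"
  shows "add_subgroup {x \<in> M. b x y - frag_cmul (flag_pairing x y) m \<in> R}"
  unfolding add_subgroup_def
proof (intro conjI ballI)
  have "b (0 - 0) y - (b 0 y - b 0 y) \<in> R"
    using b y add_subgroup_zero[OF M] unfolding biadditive_mod_def by blast
  then show "0 \<in> {x \<in> M. b x y - frag_cmul (flag_pairing x y) m \<in> R}"
    using add_subgroup_zero[OF M] by simp
next
  fix x x'
  assume "x \<in> {x \<in> M. b x y - frag_cmul (flag_pairing x y) m \<in> R}"
    and "x' \<in> {x \<in> M. b x y - frag_cmul (flag_pairing x y) m \<in> R}"
  then have x: "x \<in> M" "x' \<in> M" "b x y - frag_cmul (flag_pairing x y) m \<in> R"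
    "b x' y - frag_cmul (flag_pairing x' y) m \<in> R" by auto
  have "b (x - x') y - frag_cmul (flag_pairing (x - x') y) m =
      (b (x - x') y - (b x y - b x' y)) +
      ((b x y - frag_cmul (flag_pairing x y) m) - (b x' y - frag_cmul (flag_pairing x' y) m))"
    by (simp add: flag_pairing_diff_left frag_cmul_diff_distrib del: minus_frag_cmul)
  also have "\<dots> \<in> R"
    using b x y unfolding biadditive_mod_def
    by (intro add_subgroup_add[OF R] add_subgroup_diff[OF R x(3,4)]) blast
  finally show "x - x' \<in> {x \<in> M. b x y - frag_cmul (flag_pairing x y) m \<in> R}"
    using add_subgroup_diff[OF M] x by simp
qed

lemma multiple_of_pairing_right:
  assumes "add_subgroup R" "add_subgroup M" "biadditive_mod R M b" "x \<in> M"
  shows "add_subgroup {y \<in> M. b x y - frag_cmul (flag_pairing x y) m \<in> R}"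
  using multiple_of_pairing_left[OF assms(1,2) biadditive_mod_swap[OF assms(3)] assms(4), of m]
  by (simp add: flag_pairing_commute)

lemma flag_pairing_of_left: "flag_pairing (frag_of F) d = Poly_Mapping.lookup d F"
  by (simp add: flag_pairing_eval)

lemma flag_pairing_prepend: "flag_pairing (prepend a c) (prepend a d) = flag_pairing c d"
  using subset_UNIV[of "Poly_Mapping.keys c"]
  by (induction c rule: frag_induction) (simp_all add: flag_pairing_diff_left flag_pairing_of_left)

lemma flag_pairing_disjoint:
  assumes "\<And>F. F \<in> Poly_Mapping.keys c \<Longrightarrow> F \<notin> Poly_Mapping.keys d"
  shows "flag_pairing c d = 0"
  unfolding flag_pairing_def
proof (rule sum.neutral, rule ballI)
  fix F assume "F \<in> Poly_Mapping.keys c"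
  from assms[OF this] have "Poly_Mapping.lookup d F = 0" by (simp add: in_keys_iff)
  then show "Poly_Mapping.lookup c F * Poly_Mapping.lookup d F = 0" by simp
qed

section \<open>The action of the linear group\<close>

lemma flag_action_simps [simp]:
  "flag_action g 0 = 0" "flag_action g (frag_of F) = frag_of (map ((`) g) F)"
  "flag_action g (c - d) = flag_action g c - flag_action g d"
  by (simp_all add: flag_action_def frag_extend_diff)

lemma flag_action_prepend [simp]:
  "flag_action g (prepend H c) = prepend (g ` H) (flag_action g c)"
  by (simp add: flag_action_def prepend_def frag_extend_frag_extend)

lemma keys_flag_action:
  assumes "E \<in> Poly_Mapping.keys (flag_action g c)"
  obtains F where "F \<in> Poly_Mapping.keys c" "E = map ((`) g) F"
  using assms unfolding flag_action_def by (rule keys_frag_extend_in) (auto intro: that)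

context finite_dimensional_vector_space
begin

lemma add_subgroup_St: "add_subgroup (St W)"
  unfolding add_subgroup_def
proof (intro conjI ballI)
  fix c d assume "c \<in> St W" "d \<in> St W"
  then show "c - d \<in> St W"
    using keys_diff[of c d] by (auto simp: St_def)
qed (simp add: St_def)

lemma GL_linear:
  assumes "g \<in> GL scale"
  shows "Vector_Spaces.linear scale scale g" "inj g"
  using assms by (auto simp: GL_def bij_is_inj)

lemma GL_span:
  assumes "g \<in> GL scale"
  shows "g ` span S = span (g ` S)"
proof -
  interpret g: Vector_Spaces.linear scale scale g by (rule GL_linear[OF assms])
  show ?thesis by (rule g.span_image[symmetric])
qed

lemma GL_dim:
  assumes g: "g \<in> GL scale"
  shows "dim (g ` S) = dim S"
proof -
  interpret finite_dimensional_vector_space_pair scale Basis scale Basis ..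
  show ?thesis
    using GL_linear[OF g] by (intro dim_image_eq) (auto intro: inj_on_subset)
qed

lemma GL_zero: "g \<in> GL scale \<Longrightarrow> g 0 = 0"
  using GL_linear(1) module_hom.zero Vector_Spaces.linear.axioms(3) by fastforce

lemma GL_add: "g \<in> GL scale \<Longrightarrow> g (x + y) = g x + g y"
  using GL_linear(1) module_hom.add Vector_Spaces.linear.axioms(3) by fastforce

lemma GL_subspace:
  assumes "g \<in> GL scale" "subspace S"
  shows "subspace (g ` S)"
  using GL_span[OF assms(1), of S] assms(2) by (metis span_eq_iff)

lemma flag_action_cone:
  assumes g: "g \<in> GL scale"
  shows "flag_action g (cone u c) = cone (g u) (flag_action g c)"
  using subset_UNIV[of "Poly_Mapping.keys c"]
proof (induction c rule: frag_induction)
  case (one F)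
  show ?case
    by (induction F) (simp_all add: GL_span[OF g])
qed simp_all

lemma flag_action_suspension:
  assumes "g \<in> GL scale"
  shows "flag_action g (suspension u K c) = suspension (g u) (g ` K) (flag_action g c)"
  by (simp add: suspension_def flag_action_cone[OF assms])

lemma complete_flag_image:
  assumes g: "g \<in> GL scale"
  shows "complete_flag W F \<Longrightarrow> complete_flag (g ` W) (map ((`) g) F)"
proof (induction F arbitrary: W)
  case (Cons H F)
  then show ?case by (auto simp: GL_dim[OF g] GL_subspace[OF g])
qed (simp add: GL_dim[OF g])

lemma flag_action_in_St:
  assumes g: "g \<in> GL scale" and c: "c \<in> St W"
  shows "flag_action g c \<in> St (g ` W)"
proof -
  have "complete_flag (g ` W) E" if "E \<in> Poly_Mapping.keys (flag_action g c)" for E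
    using that by (rule keys_flag_action) (use complete_flag_image[OF g] St_flag[OF c] in auto)
  then show ?thesis
    using c simplicial_boundary_flag_action[of g c] by (simp add: St_def)
qed

lemma generic_flag_action:
  assumes g: "g \<in> GL scale" and c: "generic v c"
  shows "generic (g v) (flag_action g c)"
  unfolding generic_def
proof
  fix E assume "E \<in> Poly_Mapping.keys (flag_action g c)"
  then obtain F where F: "F \<in> Poly_Mapping.keys c" "E = map ((`) g) F" by (rule keys_flag_action)
  have "top_space E = g ` top_space F"
    using F(2) GL_zero[OF g] by (cases F) auto
  then show "g v \<notin> top_space E"
    using c F(1) GL_linear(2)[OF g] by (auto simp: generic_def inj_image_mem_iff)
qed

lemma complete_flag_subset: "complete_flag W F \<Longrightarrow> H \<in> set F \<Longrightarrow> H \<subseteq> W"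
  by (induction F arbitrary: W) auto

lemma flag_action_cong:
  assumes c: "c \<in> St W" and eq: "\<And>x. x \<in> W \<Longrightarrow> h x = g x"
  shows "flag_action h c = flag_action g c"
  unfolding flag_action_def
proof (rule frag_extend_eq)
  fix F assume F: "F \<in> Poly_Mapping.keys c"
  have "h ` H = g ` H" if "H \<in> set F" for H
    using complete_flag_subset[OF St_flag[OF c F] that] eq by (intro image_cong) auto
  then show "frag_of (map ((`) h) F) = frag_of (map ((`) g) F)" by (simp cong: map_cong)
qed

lemma GL_extend:
  assumes "independent B" "independent (f ` B)" "inj_on f B"
  obtains g where "g \<in> GL scale" "\<forall>b\<in>B. g b = f b"
proof -
  obtain g where g: "Vector_Spaces.linear scale scale g" "inj g" "\<forall>b\<in>B. g b = f b"
    using linear_independent_extend_inj[OF assms] by blast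
  then have "g \<in> GL scale" using linear_inj_imp_surj by (auto simp: GL_def bij_def)
  with g show ?thesis using that by blast
qed

lemma basis_containing:
  assumes "subspace K" "k \<in> K" "k \<noteq> 0"
  obtains B where "finite B" "k \<in> B" "independent B" "span B = K" "card B = dim K"
proof -
  obtain B where B: "{k} \<subseteq> B" "B \<subseteq> K" "independent B" "K \<subseteq> span B"
    using maximal_independent_subset_extend[of "{k}" K] assms by auto
  have "span B = K" using B assms by (intro subset_antisym span_minimal) auto
  then show ?thesis
    using that[of B] B finiteI_independent dim_span_eq_card_independent by auto
qed

lemma GL_transitive:
  assumes "subspace K1" "subspace K2" "dim K1 = dim K2" "k1 \<in> K1" "k2 \<in> K2" "k1 \<noteq> 0" "k2 \<noteq> 0"
  obtains g where "g \<in> GL scale" "g ` K1 = K2" "g k1 = k2"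
proof -
  obtain B1 where B1: "finite B1" "k1 \<in> B1" "independent B1" "span B1 = K1" "card B1 = dim K1"
    using basis_containing[of K1 k1] assms by blast
  obtain B2 where B2: "finite B2" "k2 \<in> B2" "independent B2" "span B2 = K2" "card B2 = dim K2"
    using basis_containing[of K2 k2] assms by blast
  have "card (B1 - {k1}) = card (B2 - {k2})" using B1 B2 assms(3) by simp
  then obtain h where h: "bij_betw h (B1 - {k1}) (B2 - {k2})"
    using finite_same_card_bij[of "B1 - {k1}" "B2 - {k2}"] B1 B2 by blast
  define f where "f = h(k1 := k2)"
  have "bij_betw f (insert k1 (B1 - {k1})) (insert k2 (B2 - {k2}))"
    using bij_betw_combine[of f "{k1}" "{k2}" "B1 - {k1}" "B2 - {k2}"]
      bij_betw_cong[of "B1 - {k1}" f h "B2 - {k2}"] h by (simp add: f_def)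
  then have f: "bij_betw f B1 B2" using B1 B2 by (simp add: insert_absorb)
  obtain g where g: "g \<in> GL scale" "\<forall>b\<in>B1. g b = f b"
    using GL_extend[of B1 f] f B1 B2 by (auto simp: bij_betw_def)
  have "g ` B1 = B2" using f g by (auto simp: bij_betw_def)
  then have "g ` K1 = K2" using GL_span[OF g(1), of B1] B1 B2 by simp
  moreover have "g k1 = k2" using g B1 by (simp add: f_def)
  ultimately show ?thesis using g that by blast
qed

text \<open>
  As long as \<open>v\<close> lies in neither subspace, passing to the stabiliser of \<open>v\<close> loses none of the
  isomorphisms that \<open>GL\<close> induces between the two.
\<close>

lemma GL_extend_fixing:
  assumes g: "g \<in> GL scale" and K1: "subspace K1" and gK: "g ` K1 = K2"
    and v: "v \<notin> K1" "v \<notin> K2"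
  obtains h where "h \<in> GL scale" "h v = v" "\<forall>x\<in>K1. h x = g x"
proof -
  obtain B where B: "independent B" "span B = K1" "B \<subseteq> K1"
    using basis_subspace_exists[OF K1] by metis
  interpret g: Vector_Spaces.linear scale scale g by (rule GL_linear[OF g])
  interpret vector_space_pair scale scale ..
  let ?f = "g(v := v)"
  have vB: "v \<notin> B" using B v by auto
  then have img: "?f ` insert v B = insert v (g ` B)" by auto
  have gB: "independent (g ` B)" "span (g ` B) = K2"
    using g.independent_inj_image[OF B(1)] GL_linear(2)[OF g] GL_span[OF g, of B] B gK by auto
  have "independent (insert v B)" "independent (insert v (g ` B))"
    using B gB v by (auto simp: independent_insert)
  moreover have "v \<notin> g ` B" using gB v span_superset[of "g ` B"] by auto
  then have "inj_on ?f B"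
    using inj_on_subset[OF GL_linear(2)[OF g]] by (intro inj_on_fun_updI) auto
  with \<open>v \<notin> g ` B\<close> vB have "inj_on ?f (insert v B)"
    by (auto simp: fun_upd_image)
  ultimately obtain h where h: "h \<in> GL scale" "\<forall>b\<in>insert v B. h b = ?f b"
    using GL_extend[of "insert v B" ?f] img by metis
  have "h x = g x" if "x \<in> K1" for x
  proof (rule linear_eq_on[OF GL_linear(1)[OF h(1)] GL_linear(1)[OF g]])
    show "x \<in> span B" using that B by simp
    show "h b = g b" if "b \<in> B" for b using h(2) that vB by auto
  qed
  with h show ?thesis using that[of h] by auto
qed

end

context finite_dimensional_vector_space
begin

section \<open>Decomposition along a hyperplane\<close>

lemma hyperplane_avoiding:
  assumes "subspace W" "v \<in> W" "v \<noteq> 0"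
  obtains K where "subspace K" "v \<notin> K" "W = span (insert v K)" "dim W = Suc (dim K)"
proof -
  obtain B where B: "finite B" "v \<in> B" "independent B" "span B = W" "card B = dim W"
    using basis_containing[OF assms] .
  let ?K = "span (B - {v})"
  have v: "v \<notin> ?K" using B by (auto simp: dependent_def)
  have W: "span (insert v ?K) = W"
  proof (rule subset_antisym)
    have "?K \<subseteq> W" using B span_mono[of "B - {v}" B] by auto
    then show "span (insert v ?K) \<subseteq> W" using assms by (intro span_minimal) auto
    have "B \<subseteq> insert v ?K" using span_superset[of "B - {v}"] by auto
    then show "W \<subseteq> span (insert v ?K)" using B(4) span_mono by blast
  qed
  then have "dim W = dim (insert v ?K)" by (metis dim_span)
  then show ?thesis
    using that[of ?K] v W by (simp add: dim_insert_subspace)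
qed

text \<open>
  Lines in \<open>\<langle>v\<rangle> \<oplus> K\<close> outside \<open>K\<close> are parametrised by \<open>K\<close>.
\<close>

lemma line_generator:
  assumes K: "subspace K" "v \<notin> K" and l: "subspace l" "dim l = 1" "l \<subseteq> span (insert v K)" "\<not> l \<subseteq> K"
  obtains k where "k \<in> K" "l = span {v + k}"
proof -
  obtain u where u: "u \<in> l" "u \<notin> K" using l by blast
  obtain a where a: "u - scale a v \<in> K"
    using u l(3) K(1) by (auto simp: span_insert span_eq_iff[THEN iffD2])
  have "a \<noteq> 0" using a u by auto
  let ?k = "scale (inverse a) (u - scale a v)"
  have k: "?k \<in> K" by (rule subspace_scale[OF K(1) a])
  have "v + ?k = scale (inverse a) u" using \<open>a \<noteq> 0\<close> by (simp add: scale_right_diff_distrib)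
  then have "v + ?k \<in> l" using u l(1) by (simp add: subspace_scale)
  moreover have "v + ?k \<noteq> 0"
    using K k by (metis add.commute add_eq_0_iff subspace_neg)
  ultimately have "span {v + ?k} = l"
    using l(1,2) span_minimal[of "{v + ?k}" l] by (intro subspace_dim_equal) auto
  then show ?thesis using that k by blast
qed

lemma add_notin: "subspace K \<Longrightarrow> v \<notin> K \<Longrightarrow> k \<in> K \<Longrightarrow> v + k \<notin> K"
  by (metis add_diff_cancel subspace_diff)

lemma span_insert_add:
  assumes "subspace K" "v \<notin> K" "k \<in> K"
  shows "span (insert (v + k) K) = span (insert v K)"
proof (rule span_insert_eq)
  have "v \<in> span (insert v K)" "k \<in> span (insert v K)"
    using assms(3) by (auto intro: span_base)
  then show "v + k \<in> span (insert v K)" by (rule span_add)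
  show "K \<subseteq> span (insert v K)" using span_superset[of "insert v K"] by auto
qed (use assms add_notin in \<open>auto simp: dim_insert_subspace\<close>)

text \<open>
  The difference of the two sides is killed by all projections from lines outside \<open>K\<close>, hence
  all its flags end in lines inside \<open>K\<close>, and \<open>St_eq_0\<close> applies. The sum runs over the lines \<open>l\<close> outside
  \<open>K\<close> at which flags of \<open>x\<close> end, and \<open>y l\<close> is the projection of \<open>x\<close>. A flag of \<open>y l\<close> comes from a flag of \<open>x\<close>
  through \<open>v + \<kappa> l\<close>, whose largest member would contain \<open>v\<close> if the flag of \<open>y l\<close> had a member
  containing \<open>\<kappa> l\<close>.
\<close>

lemma St_hyperplane_decomposition:
  assumes x: "x \<in> St W" and K: "subspace K" "v \<notin> K" "W = span (insert v K)" "dim K \<noteq> 0"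
  obtains L :: "'b set set" and \<kappa> y where "\<forall>l\<in>L. \<kappa> l \<in> K \<and> y l \<in> St K"
    "x = (\<Sum>l\<in>L. frag_cmul ((-1) ^ dim K) (suspension (v + \<kappa> l) K (y l)))"
    "generic v x \<longrightarrow> (\<forall>l\<in>L. \<kappa> l \<noteq> 0 \<and> generic (\<kappa> l) (y l))"
proof -
  have W: "subspace W" "dim W = Suc (dim K)" "W \<subseteq> span (insert v K)" "\<not> W \<subseteq> K" "W \<inter> K = K"
    using K span_superset[of "insert v K"] by (auto simp: dim_insert_subspace)
  then have dimW: "dim W \<noteq> 1" using K by simp
  define L where "L = last ` Poly_Mapping.keys x \<inter> {l. \<not> l \<subseteq> K}"
  have line: "\<exists>k. k \<in> K \<and> last F = span {v + k}"
    if F: "complete_flag W F" "F \<noteq> []" "\<not> last F \<subseteq> K" for F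
  proof -
    note l = complete_flag_last[OF F(1,2)]
    have "last F \<subseteq> span (insert v K)" using order_trans[OF l(1,2)] K(3) by simp
    then show ?thesis using line_generator[OF K(1,2) l(3,4) _ F(3)] by metis
  qed
  have "\<exists>k. k \<in> K \<and> l = span {v + k}" if "l \<in> L" for l
    using that line St_flag[OF x] St_nonempty[OF x dimW] by (auto simp: L_def)
  then obtain \<kappa> where \<kappa>: "\<And>l. l \<in> L \<Longrightarrow> \<kappa> l \<in> K" "\<And>l. l \<in> L \<Longrightarrow> span {v + \<kappa> l} = l"
    by metis
  define y where "y = (\<lambda>l. project K l x)"
  have y: "y l \<in> St K" if "l \<in> L" for l
    using project_in_St[OF x dimW W(1,3) K(1) add_notin[OF K(1,2) \<kappa>(1)[OF that]]]
    by (simp add: y_def \<kappa>(2)[OF that] W(5))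
  let ?s = "(-1) ^ dim K :: int"
  let ?S = "\<lambda>l. frag_cmul ?s (suspension (v + \<kappa> l) K (y l))"
  have "finite L" by (simp add: L_def)
  define z where "z = x - (\<Sum>l\<in>L. ?S l)"
  have "suspension (v + \<kappa> l) K (y l) \<in> St W" if "l \<in> L" for l
    using suspension_in_St[OF K(1) add_notin[OF K(1,2) \<kappa>(1)] y, OF that that]
      span_insert_add[OF K(1,2) \<kappa>(1), OF that] K(3) by simp
  then have z: "z \<in> St W"
    unfolding z_def
    by (intro add_subgroup_diff add_subgroup_sum add_subgroup_cmul add_subgroup_St x)
  have proj0: "project K l x = 0" if "l \<notin> L" "\<not> l \<subseteq> K" for l
    unfolding project_def
  proof (rule frag_extend_eq_0)
    fix F assume F: "F \<in> Poly_Mapping.keys x"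
    then have "last F \<noteq> l" using that by (auto simp: L_def)
    then show "project_flag K l F = 0" by (intro project_flag_eq_0[OF St_flag[OF x F]]) auto
  qed
  have zproj: "project K (span {v + k}) z = 0" if k: "k \<in> K" for k
  proof -
    let ?l = "span {v + k}"
    have "\<not> ?l \<subseteq> K" using add_notin[OF K(1,2) k] span_base[of "v + k"] by auto
    have "project K ?l (?S l) = (if ?l = l then y l else 0)" if l: "l \<in> L" for l
      using project_suspension[OF y[OF l] K(1) add_notin[OF K(1,2) \<kappa>(1)[OF l]] add_notin[OF K(1,2) k]]
        \<kappa>(2)[OF l] by (simp flip: power_add)
    then have "project K ?l z = project K ?l x - (\<Sum>l\<in>L. if ?l = l then y l else 0)"
      unfolding z_def using \<open>finite L\<close> by simp
    also have "\<dots> = 0"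
      using \<open>finite L\<close> proj0[of ?l] \<open>\<not> ?l \<subseteq> K\<close> by (simp add: y_def)
    finally show ?thesis .
  qed
  have "z = 0"
  proof (rule St_eq_0[OF z W(1,3) K(1) W(4)])
    fix F assume F: "F \<in> Poly_Mapping.keys z"
    have "F \<noteq> []" using F St_nonempty[OF z dimW] by blast
    moreover have "last F \<subseteq> K"
    proof (rule ccontr)
      assume "\<not> last F \<subseteq> K"
      then obtain k where k: "k \<in> K" "last F = span {v + k}"
        using line[OF St_flag[OF z F] \<open>F \<noteq> []\<close>] by blast
      show False
        using last_neq_if_project_eq_0[OF z W(3) K(1) add_notin[OF K(1,2) k(1)] zproj[OF k(1)] F \<open>F \<noteq> []\<close>]
          k(2) by contradiction
    qed
    ultimately show "last (W # F) \<subseteq> K" by simp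
  qed
  then have "x = (\<Sum>l\<in>L. ?S l)" by (simp add: z_def)
  moreover have "\<kappa> l \<noteq> 0 \<and> generic (\<kappa> l) (y l)" if gen: "generic v x" and l: "l \<in> L" for l
  proof -
    have key: "v \<notin> T" if F: "F \<in> Poly_Mapping.keys x" "T \<subseteq> top_space F" for F T
      using gen F by (auto simp: generic_def)
    obtain F where F: "F \<in> Poly_Mapping.keys x" "l = last F" using l by (auto simp: L_def)
    have "F \<noteq> []" using F(1) St_nonempty[OF x dimW] by blast
    then have "l \<subseteq> top_space F" using complete_flag_last(1)[OF St_flag[OF x F(1)]] F(2) by simp
    then have "v \<notin> span {v + \<kappa> l}" using key[OF F(1)] \<kappa>(2)[OF l] by simp
    then have "\<kappa> l \<noteq> 0" using span_base[of v "{v}"] by auto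
    moreover have "generic (\<kappa> l) (y l)"
      unfolding generic_def
    proof
      fix E assume "E \<in> Poly_Mapping.keys (y l)"
      then obtain F where F: "F \<in> Poly_Mapping.keys x" "E \<in> Poly_Mapping.keys (project_flag K l F)"
        unfolding y_def project_def by (rule keys_frag_extend_in)
      have T: "v + \<kappa> l \<in> top_space F" "top_space E \<subseteq> top_space F"
        using complete_flag_project[OF St_flag[OF x F(1)] W(1,3) K(1) add_notin[OF K(1,2) \<kappa>(1)[OF l]], of E]
          F(2) \<kappa>(2)[OF l] by auto
      have "subspace (top_space F)" using complete_flag_top(1)[OF St_flag[OF x F(1)] W(1)] .
      then show "\<kappa> l \<notin> top_space E"
        using T key[OF F(1) order_refl] by (metis add_diff_cancel_right' subsetD subspace_diff)
    qed
    ultimately show ?thesis ..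
  qed
  ultimately show ?thesis using that[of L \<kappa> y] \<kappa>(1) y by blast
qed

section \<open>Invariant forms\<close>

lemma generic_suspension_diff:
  assumes K: "subspace K" "v \<notin> K" and k: "k \<in> K" and x: "x \<in> St K" and gen: "generic k x"
  shows "generic v (suspension (v + k) K x)"
proof -
  have "generic (- k) x"
    unfolding generic_def
  proof
    fix F assume F: "F \<in> Poly_Mapping.keys x"
    have "subspace (top_space F)" using complete_flag_top(1)[OF St_flag[OF x F] K(1)] .
    then show "- k \<notin> top_space F"
      using gen F subspace_neg[of "top_space F" "- k"] by (auto simp: generic_def)
  qed
  then have "generic (v + k + - k) (suspension (v + k) K x)"
    using K(1) k by (intro generic_suspension_sum[OF K(1) x _ _ add_notin[OF K k]])
      (auto simp: subspace_neg)
  then show ?thesis by simp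
qed

text \<open>
  The flags in the cone with apex \<open>\<langle>v\<rangle>\<close> have largest members through \<open>v\<close>, so they do not occur in
  \<open>suspension (v + k) K x\<close>, which is generic for \<open>v\<close>. The flags in the cone with apex \<open>\<langle>v + k\<rangle>\<close> do not have \<open>K\<close> as
  largest member. Only the cones with apex \<open>K\<close> remain on both sides.
\<close>

lemma flag_pairing_suspension:
  assumes K: "subspace K" "v \<notin> K" and k: "k \<in> K" and x: "x \<in> St K" and y: "y \<in> St K"
    and gen: "generic k x"
  shows "flag_pairing (suspension (v + k) K x) (suspension v K y) = flag_pairing x y"
proof -
  have vk: "v + k \<notin> K" by (rule add_notin[OF K k])
  have gv: "generic v (suspension (v + k) K x)"
    by (rule generic_suspension_diff[OF K k x gen])
  have cone_top: "u \<in> top_space E" if "E \<in> Poly_Mapping.keys (cone u c)" "c \<in> St K" "u \<notin> K" for u c E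
  proof -
    obtain F where F: "F \<in> Poly_Mapping.keys c" "E \<in> Poly_Mapping.keys (cone_flag u F)"
      using \<open>E \<in> Poly_Mapping.keys (cone u c)\<close> unfolding cone_def by (rule keys_frag_extend_in)
    then have "top_space E = span (insert u (top_space F))"
      using complete_flag_cone[OF St_flag[OF that(2)] K(1) that(3)] by blast
    then show ?thesis using span_base[of u "insert u (top_space F)"] by simp
  qed
  have "flag_pairing (suspension (v + k) K x) (cone v y) = 0"
    using gv cone_top[OF _ y K(2)] by (intro flag_pairing_disjoint) (auto simp: generic_def)
  then have "flag_pairing (suspension (v + k) K x) (suspension v K y) =
      flag_pairing (suspension (v + k) K x) (prepend K y)"
    by (simp add: suspension_def[of v] flag_pairing_diff_right)
  also have "\<dots> = flag_pairing x y - flag_pairing (cone (v + k) x) (prepend K y)"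
    by (simp add: suspension_def flag_pairing_diff_left flag_pairing_prepend)
  also have "flag_pairing (cone (v + k) x) (prepend K y) = 0"
  proof (rule flag_pairing_disjoint)
    fix E assume "E \<in> Poly_Mapping.keys (cone (v + k) x)"
    then have "v + k \<in> top_space E" by (rule cone_top[OF _ x vk])
    then show "E \<notin> Poly_Mapping.keys (prepend K y)"
      using vk keys_prepend[of K y] by auto
  qed
  finally show ?thesis by simp
qed

text \<open>
  By iterated suspension one obtains the apartments of the bases \<open>v\<^sub>1 + v\<^sub>2, \<dots>, v\<^bsub>n-1\<^esub> + v\<^sub>n, v\<^sub>n\<close> and
  \<open>v\<^sub>1, \<dots>, v\<^sub>n\<close>, which have exactly one flag in common.
\<close>

lemma exists_pairing_one:
  assumes "subspace W" "v \<in> W" "v \<noteq> 0"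
  obtains x y where "x \<in> St W" "y \<in> St W" "generic v x" "flag_pairing x y = 1"
proof -
  have "\<exists>x\<in>St W. \<exists>y\<in>St W. generic v x \<and> flag_pairing x y = 1"
    using assms
  proof (induction "dim W" arbitrary: W v rule: less_induct)
    case less
    obtain K where K: "subspace K" "v \<notin> K" "W = span (insert v K)" "dim W = Suc (dim K)"
      using hyperplane_avoiding[OF less.prems] .
    show ?case
    proof (cases "dim K = 0")
      case True
      then have "frag_of [] \<in> St W" using K by (simp add: St_def)
      then show ?thesis
        using less.prems(3) by (intro bexI[of _ "frag_of []"]) (auto simp: generic_def flag_pairing_of)
    next
      case False
      then obtain k where k: "k \<in> K" "k \<noteq> 0" by auto
      obtain x y where xy: "x \<in> St K" "y \<in> St K" "generic k x" "flag_pairing x y = 1"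
        using less.hyps[OF _ K(1) k] K(4) by auto
      have "generic v (suspension (v + k) K x)"
        by (rule generic_suspension_diff[OF K(1,2) k(1) xy(1,3)])
      then show ?thesis
        using suspension_in_St[OF K(1) add_notin[OF K(1,2) k(1)] xy(1)]
          suspension_in_St[OF K(1,2) xy(2)] span_insert_add[OF K(1,2) k(1)] K(3)
          flag_pairing_suspension[OF K(1,2) k(1) xy(1,2,3)] xy(4)
        by (intro bexI[of _ "suspension (v + k) K x"] bexI[of _ "suspension v K y"]) auto
    qed
  qed
  then show ?thesis using that by blast
qed

text \<open>
  By \<open>St_line_decomposition\<close> it is enough to treat suspensions of cycles of a hyperplane \<open>H\<close>. By induction these cycles
  may be taken generic for some \<open>k\<close>, and then their suspensions are generic for \<open>v + k\<close>.
\<close>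

lemma St_generated_by_generic:
  assumes "subspace W" "dim W \<noteq> 0" "add_subgroup X"
    and "\<And>x v. x \<in> St W \<Longrightarrow> v \<in> W \<Longrightarrow> v \<noteq> 0 \<Longrightarrow> generic v x \<Longrightarrow> x \<in> X"
  shows "St W \<subseteq> X"
  using assms
proof (induction "dim W" arbitrary: W X rule: less_induct)
  case less
  obtain v where v: "v \<in> W" "v \<noteq> 0" using less.prems(2) by auto
  show ?case
  proof (cases "dim W = 1")
    case True
    show ?thesis
    proof
      fix x assume x: "x \<in> St W"
      have "top_space F = {0}" if "F \<in> Poly_Mapping.keys x" for F
        using complete_flag_length[OF St_flag[OF x that]] True by simp
      then have "generic v x" using v(2) by (auto simp: generic_def)
      then show "x \<in> X" by (rule less.prems(4)[OF x v])
    qed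
  next
    case False
    show ?thesis
    proof
      fix x assume x: "x \<in> St W"
      have "suspension v H (link H x) \<in> X" if H: "H \<in> hd ` Poly_Mapping.keys x" "v \<notin> H" for H
      proof -
        note H' = St_top[OF x False H(1)]
        have span: "span (insert v H) = W"
          using H' H(2) less.prems(1) v(1) by (intro span_insert_eq) auto
        let ?X = "{c. suspension v H c \<in> X}"
        have "add_subgroup ?X"
          using less.prems(3) by (simp add: add_subgroup_def)
        moreover have "c \<in> ?X" if c: "c \<in> St H" "k \<in> H" "generic k c" for c k
        proof -
          have "suspension v H c \<in> St W" using suspension_in_St[OF H'(1) H(2) c(1)] span by simp
          moreover have "generic (v + k) (suspension v H c)"
            by (rule generic_suspension_sum[OF H'(1) c(1,3,2) H(2)])
          moreover have "v + k \<in> W" using c(2) v(1) H'(2) less.prems(1) by (auto intro: subspace_add)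
          moreover have "v + k \<noteq> 0"
            using add_notin[OF H'(1) H(2) c(2)] subspace_0[OF H'(1)] by metis
          ultimately show ?thesis using less.prems(4) by blast
        qed
        moreover have "dim H \<noteq> 0" using H'(3) False by simp
        ultimately have "St H \<subseteq> ?X" using H' by (intro less.hyps) auto
        then show ?thesis using link_in_St[OF x] by blast
      qed
      then have "(\<Sum>H | H \<in> hd ` Poly_Mapping.keys x \<and> v \<notin> H. suspension v H (link H x)) \<in> X"
        by (intro add_subgroup_sum[OF less.prems(3)]) blast
      then show "x \<in> X" using St_line_decomposition[OF x False v(2)] by simp
    qed
  qed
qed

text \<open>
  The induction on the dimension: \<open>sus K k\<close> below is the form induced on \<open>St K\<close> by suspension, and \<open>m\<close> is
  taken from the induction hypothesis for one reference pair \<open>K0\<close>, \<open>k0\<close>. Elements of \<open>GL\<close>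
  that fix \<open>v\<close> carry any other pair \<open>K\<close>, \<open>k\<close> to the reference pair, so the same \<open>m\<close> serves for all pairs.
\<close>

theorem generic_form_is_multiple_of_pairing:
  fixes b :: "('b set list \<Rightarrow>\<^sub>0 int) \<Rightarrow> ('b set list \<Rightarrow>\<^sub>0 int) \<Rightarrow> ('p \<Rightarrow>\<^sub>0 int)"
  assumes R: "add_subgroup R" and W: "subspace W" and v: "v \<in> W" "v \<noteq> 0"
    and b: "biadditive_mod R (St W) b"
    and inv: "\<And>g x y. g \<in> GL scale \<Longrightarrow> g ` W = W \<Longrightarrow> g v = v \<Longrightarrow> x \<in> St W \<Longrightarrow> y \<in> St W \<Longrightarrow>
      b (flag_action g x) (flag_action g y) - b x y \<in> R"
  shows "\<exists>m. \<forall>x\<in>St W. \<forall>y\<in>St W. generic v x \<longrightarrow> b x y - frag_cmul (flag_pairing x y) m \<in> R"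
  using W v b inv
proof (induction "dim W" arbitrary: W v b rule: less_induct)
  case less
  note W = less.prems(1) and v = less.prems(2,3) and b = less.prems(4) and inv = less.prems(5)
  note left = multiple_of_pairing_left[OF R add_subgroup_St b]
  note right = multiple_of_pairing_right[OF R add_subgroup_St b]
  obtain K0 where K0: "subspace K0" "v \<notin> K0" "W = span (insert v K0)" "dim W = Suc (dim K0)"
    using hyperplane_avoiding[OF W v] .
  show ?case
  proof (cases "dim K0 = 0")
    case True
    \<comment> \<open>In a line the empty flag is the only one, and it generates the cycles.\<close>
    let ?m = "b (frag_of []) (frag_of [])"
    have pt: "frag_of [] \<in> St W" using True K0 by (simp add: St_def)
    have multiple: "St W \<subseteq> X" if X: "add_subgroup X" "frag_of [] \<in> X" for X
    proof
      fix x assume x: "x \<in> St W"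
      have "Poly_Mapping.keys x \<subseteq> {[]}"
        using complete_flag_length[OF St_flag[OF x]] True K0(4) by force
      then show "x \<in> X"
        by (induction x rule: frag_induction) (use X in \<open>auto intro: add_subgroup_zero add_subgroup_diff\<close>)
    qed
    have 1: "b x (frag_of []) - frag_cmul (flag_pairing x (frag_of [])) ?m \<in> R" if "x \<in> St W" for x
      using multiple[OF left[OF pt, of ?m]] that pt add_subgroup_zero[OF R] by (auto simp: flag_pairing_of)
    have "b x y - frag_cmul (flag_pairing x y) ?m \<in> R" if "x \<in> St W" "y \<in> St W" for x y
      using multiple[OF right[OF that(1), of ?m]] 1[OF that(1)] that(2) pt by auto
    then show ?thesis by blast
  next
    case False
    then obtain k0 where k0: "k0 \<in> K0" "k0 \<noteq> 0" by auto
    define sus where "sus = (\<lambda>K k x y. b (suspension (v + k) K x) (suspension v K y))"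
    have susp: "suspension (v + k) K x \<in> St W"
      if "subspace K" "v \<notin> K" "W = span (insert v K)" "k \<in> K" "x \<in> St K" for K k x
      using suspension_in_St[OF that(1) add_notin[OF that(1,2,4)] that(5)] span_insert_add[OF that(1,2,4)]
        that(3) by simp
    have susp0: "suspension v K x \<in> St W"
      if "subspace K" "v \<notin> K" "W = span (insert v K)" "x \<in> St K" for K x
      using suspension_in_St[OF that(1,2,4)] that(3) by simp
    \<comment> \<open>With one reference pair on both sides this is the invariance needed for the induction hypothesis;
      with different pairs it shows that the multiple does not depend on the pair.\<close>
    have transport: "sus K0 k0 (flag_action g x) (flag_action g y) - sus K k x y \<in> R"
      if K: "subspace K" "v \<notin> K" "W = span (insert v K)" "k \<in> K"
        and g: "g \<in> GL scale" "g ` K = K0" "g k = k0" and x: "x \<in> St K" and y: "y \<in> St K"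
      for K k g x y
    proof -
      obtain h where h: "h \<in> GL scale" "h v = v" "\<forall>x\<in>K. h x = g x"
        using GL_extend_fixing[OF g(1) K(1) g(2) K(2) K0(2)] .
      have hK: "h ` K = K0" using h(3) g(2) by (metis image_cong)
      have "h ` W = span (h ` insert v K)" using GL_span[OF h(1)] K(3) by metis
      then have hW: "h ` W = W" using hK h(2) K0(3) by simp
      have "h (v + k) = v + k0" using GL_add[OF h(1)] h(2,3) g(3) K(4) by simp
      then have "flag_action h (suspension (v + k) K x) = suspension (v + k0) K0 (flag_action g x)"
        "flag_action h (suspension v K y) = suspension v K0 (flag_action g y)"
        using flag_action_suspension[OF h(1)] flag_action_cong[of _ K h g] x y hK h(2,3) by auto
      then show ?thesis
        using inv[OF h(1) hW h(2) susp[OF K x] susp0[OF K(1-3) y]] by (simp add: sus_def)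
    qed
    have "\<exists>m. \<forall>x\<in>St K0. \<forall>y\<in>St K0. generic k0 x \<longrightarrow>
        sus K0 k0 x y - frag_cmul (flag_pairing x y) m \<in> R"
    proof (rule less.hyps[OF _ K0(1) k0])
      show "dim K0 < dim W" using K0(4) by simp
      show "biadditive_mod R (St K0) (sus K0 k0)"
        using b susp[OF K0(1-3) k0(1)] susp0[OF K0(1-3)] unfolding biadditive_mod_def sus_def
        by simp
      show "sus K0 k0 (flag_action g x) (flag_action g y) - sus K0 k0 x y \<in> R"
        if "g \<in> GL scale" "g ` K0 = K0" "g k0 = k0" "x \<in> St K0" "y \<in> St K0" for g x y
        using transport[OF K0(1-3) k0(1) that] .
    qed
    then obtain m where m: "\<And>x y. x \<in> St K0 \<Longrightarrow> y \<in> St K0 \<Longrightarrow> generic k0 x \<Longrightarrow>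
        sus K0 k0 x y - frag_cmul (flag_pairing x y) m \<in> R" by blast
    have suspended: "suspension (v + k) K x \<in>
        {x \<in> St W. b x (suspension v K y) - frag_cmul (flag_pairing x (suspension v K y)) m \<in> R}"
      if K: "subspace K" "v \<notin> K" "W = span (insert v K)" and k: "k \<in> K" "k \<noteq> 0"
        and x: "x \<in> St K" "generic k x" and y: "y \<in> St K" for K k x y
    proof -
      have "dim K = dim K0"
        using K K0 by (metis dim_insert_subspace dim_span nat.inject)
      then obtain g where g: "g \<in> GL scale" "g ` K = K0" "g k = k0"
        using GL_transitive[OF K(1) K0(1) _ k(1) k0(1) k(2) k0(2)] by blast
      have "sus K0 k0 (flag_action g x) (flag_action g y) -
          frag_cmul (flag_pairing (flag_action g x) (flag_action g y)) m \<in> R"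
        using flag_action_in_St[OF g(1)] generic_flag_action[OF g(1) x(2)] x(1) y g(2,3)
        by (intro m) auto
      then have "sus K0 k0 (flag_action g x) (flag_action g y) - frag_cmul (flag_pairing x y) m \<in> R"
        by (simp add: flag_pairing_invariant[OF GL_linear(2)[OF g(1)]])
      from add_subgroup_diff[OF R this transport[OF K k(1) g x(1) y]]
      have "sus K k x y - frag_cmul (flag_pairing x y) m \<in> R" by (simp del: minus_frag_cmul)
      then show ?thesis
        using susp[OF K k(1) x(1)] flag_pairing_suspension[OF K(1,2) k(1) x(1) y x(2)]
        by (simp add: sus_def)
    qed
    have dimW: "dim W \<noteq> 1" using K0(4) False by simp
    have "b x y - frag_cmul (flag_pairing x y) m \<in> R"
      if x: "x \<in> St W" "generic v x" and y: "y \<in> St W" for x y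
    proof -
      let ?Y = "{y \<in> St W. b x y - frag_cmul (flag_pairing x y) m \<in> R}"
      have "suspension v K (link K y) \<in> ?Y" if K: "K \<in> hd ` Poly_Mapping.keys y" "v \<notin> K" for K
      proof -
        note K' = St_top[OF y dimW K(1)]
        have span: "W = span (insert v K)"
          using K' K(2) W v(1) by (intro span_insert_eq[symmetric]) auto
        have "dim K \<noteq> 0" using K'(3) dimW by simp
        obtain L :: "'b set set" and \<kappa> z where z: "\<forall>l\<in>L. \<kappa> l \<in> K \<and> z l \<in> St K"
          "x = (\<Sum>l\<in>L. frag_cmul ((-1) ^ dim K) (suspension (v + \<kappa> l) K (z l)))"
          "generic v x \<longrightarrow> (\<forall>l\<in>L. \<kappa> l \<noteq> 0 \<and> generic (\<kappa> l) (z l))"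
          using St_hyperplane_decomposition[OF x(1) K'(1) K(2) span \<open>dim K \<noteq> 0\<close>] .
        note y' = susp0[OF K'(1) K(2) span link_in_St[OF y]]
        let ?X = "{x \<in> St W. b x (suspension v K (link K y)) -
            frag_cmul (flag_pairing x (suspension v K (link K y))) m \<in> R}"
        have "(\<Sum>l\<in>L. frag_cmul ((-1) ^ dim K) (suspension (v + \<kappa> l) K (z l))) \<in> ?X"
        proof (intro add_subgroup_sum[OF left[OF y']] add_subgroup_cmul[OF left[OF y']])
          fix l assume l: "l \<in> L"
          show "suspension (v + \<kappa> l) K (z l) \<in> ?X"
            using z(1,3) x(2) l
            by (intro suspended[OF K'(1) K(2) span _ _ _ _ link_in_St[OF y]]) auto
        qed
        then have "x \<in> ?X" using z(2) by simp
        then show ?thesis using y' by simp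
      qed
      then have "(\<Sum>K | K \<in> hd ` Poly_Mapping.keys y \<and> v \<notin> K. suspension v K (link K y)) \<in> ?Y"
        by (intro add_subgroup_sum[OF right[OF x(1)]]) blast
      then show ?thesis using St_line_decomposition[OF y dimW v(2)] by simp
    qed
    then show ?thesis by blast
  qed
qed

corollary invariant_form_is_multiple_of_pairing:
  fixes v0 :: 'b and b :: "('b set list \<Rightarrow>\<^sub>0 int) \<Rightarrow> ('b set list \<Rightarrow>\<^sub>0 int) \<Rightarrow> ('p \<Rightarrow>\<^sub>0 int)"
  assumes R: "add_subgroup R" and b: "biadditive_mod R (St UNIV) b" and v0: "v0 \<noteq> 0"
    and inv: "\<And>g x y. g \<in> GL scale \<Longrightarrow> x \<in> St UNIV \<Longrightarrow> y \<in> St UNIV \<Longrightarrow>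
      b (flag_action g x) (flag_action g y) - b x y \<in> R"
  obtains m where "\<And>x y. x \<in> St UNIV \<Longrightarrow> y \<in> St UNIV \<Longrightarrow> b x y - frag_cmul (flag_pairing x y) m \<in> R"
proof -
  obtain m where m: "\<And>x y. x \<in> St UNIV \<Longrightarrow> y \<in> St UNIV \<Longrightarrow> generic v0 x \<Longrightarrow>
      b x y - frag_cmul (flag_pairing x y) m \<in> R"
    using generic_form_is_multiple_of_pairing[OF R subspace_UNIV UNIV_I v0 b inv] by blast
  have "x \<in> {x \<in> St UNIV. b x y - frag_cmul (flag_pairing x y) m \<in> R}"
    if x: "x \<in> St UNIV" "generic v x" "v \<noteq> 0" and y: "y \<in> St UNIV" for x y v
  proof -
    obtain g where g: "g \<in> GL scale" "g v = v0"
      using GL_transitive[OF subspace_UNIV subspace_UNIV refl UNIV_I UNIV_I x(3) v0] .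
    have "g ` UNIV = UNIV" using g(1) by (simp add: GL_def bij_def)
    then have gS: "flag_action g c \<in> St UNIV" if "c \<in> St UNIV" for c
      using flag_action_in_St[OF g(1) that] by simp
    have "b (flag_action g x) (flag_action g y) -
        frag_cmul (flag_pairing (flag_action g x) (flag_action g y)) m \<in> R"
      using generic_flag_action[OF g(1) x(2)] g(2) x y by (intro m gS) auto
    then have "b (flag_action g x) (flag_action g y) - frag_cmul (flag_pairing x y) m \<in> R"
      by (simp add: flag_pairing_invariant[OF GL_linear(2)[OF g(1)]])
    from add_subgroup_diff[OF R this inv[OF g(1) x(1) y]] x(1) show ?thesis
      by (simp del: minus_frag_cmul)
  qed
  then have "St UNIV \<subseteq> {x \<in> St UNIV. b x y - frag_cmul (flag_pairing x y) m \<in> R}"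
    if "y \<in> St UNIV" for y
    using that v0
    by (intro St_generated_by_generic multiple_of_pairing_left[OF R add_subgroup_St b] subspace_UNIV)
       (auto simp del: dim_UNIV)
  then show ?thesis using that by blast
qed

end

section \<open>Reversing flags\<close>

text \<open>
  Simplices of the Tits building list their subspaces upwards, the recursion above reads them
  downwards. Reversal changes the boundary only by a sign.
\<close>

definition reverse_chain :: "('a list \<Rightarrow>\<^sub>0 int) \<Rightarrow> ('a list \<Rightarrow>\<^sub>0 int)" where
  "reverse_chain = frag_extend (\<lambda>F. frag_of (rev F))"

lemma reverse_chain_simps [simp]:
  "reverse_chain 0 = 0" "reverse_chain (frag_of F) = frag_of (rev F)"
  "reverse_chain (c - d) = reverse_chain c - reverse_chain d"
  by (simp_all add: reverse_chain_def frag_extend_diff)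

lemma reverse_chain_reverse_chain [simp]: "reverse_chain (reverse_chain c) = c"
  by (simp add: reverse_chain_def frag_extend_frag_extend)

lemma lookup_reverse_chain: "Poly_Mapping.lookup (reverse_chain c) F = Poly_Mapping.lookup c (rev F)"
  using subset_UNIV[of "Poly_Mapping.keys c"]
  by (induction c rule: frag_induction) (auto simp: lookup_minus)

lemma keys_reverse_chain: "F \<in> Poly_Mapping.keys (reverse_chain c) \<longleftrightarrow> rev F \<in> Poly_Mapping.keys c"
  by (simp add: in_keys_iff lookup_reverse_chain)

lemma flag_pairing_reverse_chain:
  "flag_pairing (reverse_chain c) (reverse_chain d) = flag_pairing c d"
  using subset_UNIV[of "Poly_Mapping.keys c"]
  by (induction c rule: frag_induction)
     (simp_all add: flag_pairing_diff_left flag_pairing_of_left lookup_reverse_chain)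

lemma flag_action_reverse_chain: "flag_action g (reverse_chain c) = reverse_chain (flag_action g c)"
  using subset_UNIV[of "Poly_Mapping.keys c"]
  by (induction c rule: frag_induction) (simp_all add: rev_map)

lemma simplicial_boundary_rev:
  "simplicial_boundary (frag_of (rev F)) =
     frag_cmul ((-1) ^ (length F - 1)) (reverse_chain (simplicial_boundary (frag_of F)))"
proof -
  let ?n = "length F"
  let ?t = "\<lambda>i. frag_cmul ((-1) ^ i) (frag_of (take i (rev F) @ drop (Suc i) (rev F)))"
  have "simplicial_boundary (frag_of (rev F)) = (\<Sum>i<?n. ?t i)"
    by (simp add: simplicial_boundary_def)
  also have "\<dots> = (\<Sum>i<?n. ?t (?n - Suc i))"
    by (rule sum.nat_diff_reindex[symmetric])
  also have "\<dots> = (\<Sum>i<?n. frag_cmul ((-1) ^ (?n - 1))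
      (frag_cmul ((-1) ^ i) (frag_of (rev (take i F @ drop (Suc i) F)))))"
  proof (rule sum.cong[OF refl])
    fix i assume "i \<in> {..<?n}"
    then have i: "i < ?n" by simp
    have "even (?n - Suc i) \<longleftrightarrow> even (?n - 1 + i)" using i by (auto simp: even_diff_nat)
    then have sign: "(-1 :: int) ^ (?n - Suc i) = (-1) ^ (?n - 1) * (-1) ^ i"
      by (simp add: minus_one_power_iff flip: power_add)
    have "take (?n - Suc i) (rev F) @ drop (Suc (?n - Suc i)) (rev F) = rev (take i F @ drop (Suc i) F)"
      using i by (simp add: take_rev drop_rev Suc_diff_Suc)
    then show "?t (?n - Suc i) = frag_cmul ((-1) ^ (?n - 1))
      (frag_cmul ((-1) ^ i) (frag_of (rev (take i F @ drop (Suc i) F))))"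
      by (simp add: sign)
  qed
  also have "\<dots> = frag_cmul ((-1) ^ (?n - 1)) (reverse_chain (simplicial_boundary (frag_of F)))"
    by (simp add: simplicial_boundary_def reverse_chain_def frag_extend_sum frag_extend_cmul o_def
        frag_cmul_sum del: frag_cmul_cmul)
  finally show ?thesis .
qed

lemma simplicial_boundary_reverse_chain:
  assumes "\<And>F. F \<in> Poly_Mapping.keys c \<Longrightarrow> length F = n" "simplicial_boundary c = 0"
  shows "simplicial_boundary (reverse_chain c) = 0"
proof -
  have "simplicial_boundary (reverse_chain c) =
      frag_extend (\<lambda>F. simplicial_boundary (frag_of (rev F))) c"
    by (simp add: simplicial_boundary_def reverse_chain_def frag_extend_frag_extend)
  also have "\<dots> = frag_extend (\<lambda>F. frag_cmul ((-1) ^ (n - 1))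
      (reverse_chain (simplicial_boundary (frag_of F)))) c"
    using assms(1) by (intro frag_extend_eq) (simp add: simplicial_boundary_rev)
  also have "\<dots> = frag_cmul ((-1) ^ (n - 1)) (reverse_chain (simplicial_boundary c))"
    unfolding frag_extend_cmul_fun
    by (simp add: simplicial_boundary_def reverse_chain_def frag_extend_frag_extend)
  finally show ?thesis using assms(2) by simp
qed

context finite_dimensional_vector_space
begin

lemma complete_flag_sorted:
  assumes "complete_flag W F"
  shows "sorted_wrt (\<lambda>a b. b \<subset> a) F" "\<And>U. U \<in> set F \<Longrightarrow> subspace U \<and> U \<noteq> {0} \<and> U \<subset> W"
proof -
  have "sorted_wrt (\<lambda>a b. b \<subset> a) F \<and> (\<forall>U\<in>set F. subspace U \<and> U \<noteq> {0} \<and> U \<subset> W)"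
    using assms
  proof (induction F arbitrary: W)
    case (Cons H F)
    have H: "subspace H" "H \<subseteq> W" "dim W = Suc (dim H)" "complete_flag H F"
      using Cons.prems by auto
    have "H \<subset> W" using H(2,3) by auto
    moreover have "H \<noteq> {0}" using complete_flag_length[OF H(4)] by auto
    ultimately show ?case using Cons.IH[OF H(4)] H(1) by auto
  qed simp
  then show "sorted_wrt (\<lambda>a b. b \<subset> a) F" "\<And>U. U \<in> set F \<Longrightarrow> subspace U \<and> U \<noteq> {0} \<and> U \<subset> W"
    by auto
qed

text \<open>
  A chain of proper non-zero subspaces has at most \<open>dim W - 1\<close> members, and if it has that many it
  skips no dimension.
\<close>

lemma complete_flagI:
  assumes "sorted_wrt (\<lambda>a b. b \<subset> a) F" "\<And>U. U \<in> set F \<Longrightarrow> subspace U \<and> U \<noteq> {0} \<and> U \<subset> W"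
    "subspace W" "W \<noteq> {0}"
  shows "length F < dim W \<and> (Suc (length F) = dim W \<longrightarrow> complete_flag W F)"
  using assms
proof (induction F arbitrary: W)
  case Nil
  then have "\<not> W \<subseteq> {0}" using subspace_0 by blast
  then show ?case by (metis complete_flag.simps(1) dim_eq_0 length_0_conv list.size(3) neq0_conv One_nat_def)
next
  case (Cons H F)
  have H: "subspace H" "H \<noteq> {0}" "H \<subset> W" using Cons.prems(2)[of H] by auto
  have "dim H < dim W"
    using H Cons.prems(3) by (intro dim_psubset) (simp add: span_eq_iff[THEN iffD2])
  moreover have "length F < dim H \<and> (Suc (length F) = dim H \<longrightarrow> complete_flag H F)"
    using Cons.prems(1,2) H by (intro Cons.IH) auto
  ultimately show ?case using H by auto
qed

lemma tits_simplices_iff_complete_flag: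
  assumes "(UNIV :: 'b set) \<noteq> {0}"
  shows "\<sigma> \<in> tits_simplices scale (dim UNIV - 1) \<longleftrightarrow> complete_flag UNIV (rev \<sigma>)"
proof
  assume \<sigma>: "\<sigma> \<in> tits_simplices scale (dim UNIV - 1)"
  have "sorted_wrt (\<lambda>a b. b \<subset> a) (rev \<sigma>)"
    using \<sigma> by (simp add: tits_simplices_def sorted_wrt_rev)
  then have "length (rev \<sigma>) < dim UNIV \<and> (Suc (length (rev \<sigma>)) = dim UNIV \<longrightarrow> complete_flag UNIV (rev \<sigma>))"
    using \<sigma> assms by (intro complete_flagI) (auto simp: tits_simplices_def subspace_UNIV)
  then show "complete_flag UNIV (rev \<sigma>)"
    using \<sigma> by (auto simp: tits_simplices_def)
next
  assume F: "complete_flag UNIV (rev \<sigma>)"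
  show "\<sigma> \<in> tits_simplices scale (dim UNIV - 1)"
    using complete_flag_sorted[OF F] complete_flag_length[OF F]
    by (auto simp: tits_simplices_def sorted_wrt_rev)
qed

lemma reverse_chain_in_St:
  assumes V: "(UNIV :: 'b set) \<noteq> {0}"
  shows "reverse_chain c \<in> St UNIV \<longleftrightarrow> c \<in> carrier (steinberg scale)"
proof -
  have keys: "(\<forall>F\<in>Poly_Mapping.keys (reverse_chain c). complete_flag UNIV F) \<longleftrightarrow>
      Poly_Mapping.keys c \<subseteq> tits_simplices scale (dim UNIV - 1)"
    unfolding subset_iff tits_simplices_iff_complete_flag[OF V]
    by (metis keys_reverse_chain rev_rev_ident)
  have "simplicial_boundary (reverse_chain c) = 0 \<longleftrightarrow> simplicial_boundary c = 0"
    if k: "Poly_Mapping.keys c \<subseteq> tits_simplices scale (dim UNIV - 1)"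
  proof
    have len: "length F = dim UNIV - 1" if "F \<in> Poly_Mapping.keys c" for F
      using that k by (auto simp: tits_simplices_def)
    then show "simplicial_boundary c = 0 \<Longrightarrow> simplicial_boundary (reverse_chain c) = 0"
      by (rule simplicial_boundary_reverse_chain)
    have "length F = dim UNIV - 1" if "F \<in> Poly_Mapping.keys (reverse_chain c)" for F
      using len[of "rev F"] that by (simp add: keys_reverse_chain)
    then show "simplicial_boundary (reverse_chain c) = 0 \<Longrightarrow> simplicial_boundary c = 0"
      using simplicial_boundary_reverse_chain[of "reverse_chain c"] by simp
  qed
  then show ?thesis using keys by (auto simp: St_def carrier_steinberg)
qed

end

section \<open>Coinvariants of the tensor square\<close>

lemma frag_eval_cmul_of: "frag_eval f (frag_cmul k (frag_of p)) = k * f p"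
  by (subst frag_eval_superset[of "{p}"]) auto

theorem theorem3:
  fixes scale :: "'k::field \<Rightarrow> 'v::ab_group_add \<Rightarrow> 'v" and B :: "'v set"
  assumes "finite_dimensional_vector_space scale B"
    and "(UNIV :: 'v set) \<noteq> {0}"
  shows "coinvariants_lift (tensor_lift flag_pairing) \<in>
    iso (coinvariants (steinberg_tensor scale) (GL scale) (diagonal_action scale)) integer_group"
proof -
  interpret finite_dimensional_vector_space scale B by fact
  let ?S = "steinberg scale" and ?A = "steinberg_tensor scale" and ?h = "tensor_lift flag_pairing"
  let ?T = "tensor_free ?S ?S" and ?N = "coinvariant_rels (steinberg_tensor scale) (GL scale) (diagonal_action scale)"
  let ?gens = "{diagonal_action scale g a \<otimes>\<^bsub>?A\<^esub> inv\<^bsub>?A\<^esub> a | g a. g \<in> GL scale \<and> a \<in> carrier ?A}"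
  let ?\<pi> = "\<lambda>c. tensor_rels ?S ?S #>\<^bsub>?T\<^esub> c"
  note S = group_steinberg[of scale]
  note in_St = reverse_chain_in_St[OF assms(2)]
  interpret T: comm_group ?T by (rule comm_group_tensor_free)
  interpret A: comm_group ?A
    unfolding steinberg_tensor_def by (intro comm_group_tensor_product S)
  have h_hom: "?h \<in> hom ?A integer_group"
    unfolding steinberg_tensor_def by (intro tensor_lift_hom S biadditive_flag_pairing)
  interpret h: group_hom ?A integer_group ?h
    using h_hom by (intro group_hom.intro group_hom_axioms.intro A.is_group) simp_all
  have h_\<pi>: "?h (?\<pi> c) = frag_eval (\<lambda>(x, y). flag_pairing x y) c" if "c \<in> carrier ?T" for c
    by (rule tensor_lift_coset[OF S S biadditive_flag_pairing that])
  have \<pi>_carrier: "?\<pi> c \<in> carrier ?A" if "c \<in> carrier ?T" for c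
    using that by (auto simp: steinberg_tensor_def tensor_product_def FactGroup_def RCOSETS_def)
  have T_ops: "x \<otimes>\<^bsub>?T\<^esub> y = x + y" "\<one>\<^bsub>?T\<^esub> = 0" for x y
    by (simp_all add: tensor_free_def)
  have T_inv: "inv\<^bsub>?T\<^esub> x = - x" if "x \<in> carrier ?T" for x
    using that by (simp add: tensor_free_def)
  interpret \<pi>: group_hom ?T ?A ?\<pi>
    using \<pi>_carrier tensor_product_mult[OF S S]
    by unfold_locales (auto simp: hom_def T_ops steinberg_tensor_def)
  have \<pi>_diff: "?\<pi> (c - d) = ?\<pi> c \<otimes>\<^bsub>?A\<^esub> inv\<^bsub>?A\<^esub> ?\<pi> d" if "c \<in> carrier ?T" "d \<in> carrier ?T" for c d
  proof -
    have "?\<pi> (c \<otimes>\<^bsub>?T\<^esub> inv\<^bsub>?T\<^esub> d) = ?\<pi> c \<otimes>\<^bsub>?A\<^esub> inv\<^bsub>?A\<^esub> ?\<pi> d"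
      using that by (simp only: \<pi>.hom_mult \<pi>.hom_inv T.inv_closed)
    then show ?thesis using that by (simp add: T_ops T_inv)
  qed
  have gens: "?gens \<subseteq> carrier ?A"
    using diagonal_action_closed_invariant(1) by auto
  have N: "subgroup ?N ?A"
    unfolding coinvariant_rels_def by (rule A.generate_is_subgroup[OF gens])
  \<comment> \<open>The kernel of the projection from the free abelian group to the coinvariants.\<close>
  define R where "R = {c \<in> carrier ?T. ?\<pi> c \<in> ?N}"
  have R: "add_subgroup R"
    unfolding add_subgroup_def
  proof (intro conjI ballI)
    have "?\<pi> 0 = \<one>\<^bsub>?A\<^esub>" using \<pi>.hom_one by (simp add: T_ops)
    moreover have "0 \<in> carrier ?T" using T.one_closed by (simp add: T_ops)
    ultimately show "0 \<in> R" using subgroup.one_closed[OF N] by (simp add: R_def)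
    fix c d assume "c \<in> R" "d \<in> R"
    then have c: "c \<in> carrier ?T" "?\<pi> c \<in> ?N" and d: "d \<in> carrier ?T" "?\<pi> d \<in> ?N"
      by (auto simp: R_def)
    show "c - d \<in> R"
      using diff_in_tensor_free[OF c(1) d(1)] \<pi>_diff[OF c(1) d(1)]
        subgroup.m_closed[OF N c(2) subgroup.m_inv_closed[OF N d(2)]]
      by (simp add: R_def)
  qed
  have rels: "c \<in> R" if "c \<in> tensor_rels ?S ?S" for c
  proof -
    have c: "c \<in> carrier ?T" using that subgroup.subset[OF subgroup_tensor_rels[OF S S]] by blast
    have "?\<pi> c = tensor_rels ?S ?S"
      by (rule T.coset_join2[OF c subgroup_tensor_rels[OF S S] that])
    also have "\<dots> = \<one>\<^bsub>?A\<^esub>" by (simp add: steinberg_tensor_def tensor_product_def FactGroup_def)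
    finally show ?thesis using c subgroup.one_closed[OF N] by (simp add: R_def)
  qed
  \<comment> \<open>The universal form: its value modulo \<open>R\<close> is the class of \<open>x \<otimes> y\<close> in the coinvariants.\<close>
  let ?b = "\<lambda>x y. frag_of (reverse_chain x, reverse_chain y)"
  have rc: "reverse_chain x \<in> carrier ?S" if "x \<in> St UNIV" for x
    using in_St[of "reverse_chain x"] that by simp
  have bi: "biadditive_mod R (St UNIV) ?b"
    unfolding biadditive_mod_def
  proof (intro conjI ballI)
    fix x x' y assume xy: "x \<in> St UNIV" "x' \<in> St UNIV" "y \<in> St UNIV"
    let ?x = "reverse_chain x" and ?x' = "reverse_chain x'" and ?y = "reverse_chain y"
    have x: "?x - ?x' \<in> carrier ?S" "?x' \<in> carrier ?S" "?y \<in> carrier ?S"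
      using rc[OF add_subgroup_diff[OF add_subgroup_St xy(1,2)]] rc xy by auto
    \<comment> \<open>The defining relation of the tensor product for the sum of \<open>?x - ?x'\<close> and \<open>?x'\<close>.\<close>
    have "frag_of ((?x - ?x') \<otimes>\<^bsub>?S\<^esub> ?x', ?y) - frag_of (?x - ?x', ?y) - frag_of (?x', ?y) \<in> R"
      using x by (intro rels, unfold tensor_rels_def, intro generate.incl) blast
    from add_subgroup_uminus[OF R this]
    show "?b (x - x') y - (?b x y - ?b x' y) \<in> R"
      by (simp add: mult_steinberg algebra_simps del: minus_frag_cmul)
  next
    fix x y y' assume xy: "x \<in> St UNIV" "y \<in> St UNIV" "y' \<in> St UNIV"
    let ?x = "reverse_chain x" and ?y' = "reverse_chain y'" and ?y = "reverse_chain y"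
    have x: "?y - ?y' \<in> carrier ?S" "?y' \<in> carrier ?S" "?x \<in> carrier ?S"
      using rc[OF add_subgroup_diff[OF add_subgroup_St xy(2,3)]] rc xy by auto
    have "frag_of (?x, (?y - ?y') \<otimes>\<^bsub>?S\<^esub> ?y') - frag_of (?x, ?y - ?y') - frag_of (?x, ?y') \<in> R"
      using x by (intro rels, unfold tensor_rels_def, intro generate.incl) blast
    from add_subgroup_uminus[OF R this]
    show "?b x (y - y') - (?b x y - ?b x y') \<in> R"
      by (simp add: mult_steinberg algebra_simps del: minus_frag_cmul)
  qed
  have inv: "?b (flag_action g x) (flag_action g y) - ?b x y \<in> R"
    if g: "g \<in> GL scale" and xy: "x \<in> St UNIV" "y \<in> St UNIV" for g x y
  proof -
    let ?x = "reverse_chain x" and ?y = "reverse_chain y"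
    note x = rc[OF xy(1)] and y = rc[OF xy(2)]
    note p = frag_of_in_tensor_free[OF x y]
      and gp = frag_of_in_tensor_free[OF flag_action_in_steinberg[OF g x] flag_action_in_steinberg[OF g y]]
    have "?\<pi> (frag_of (flag_action g ?x, flag_action g ?y)) = diagonal_action scale g (?\<pi> (frag_of (?x, ?y)))"
      using tensor_map_pure[OF S S flag_action_hom[OF g] flag_action_hom[OF g] x y]
      by (simp add: diagonal_action_def pure_tensor_def)
    then have "?\<pi> (frag_of (flag_action g ?x, flag_action g ?y) - frag_of (?x, ?y)) \<in> ?gens"
      using \<pi>_diff[OF gp p] g \<pi>_carrier[OF p] by auto
    then have "?\<pi> (frag_of (flag_action g ?x, flag_action g ?y) - frag_of (?x, ?y)) \<in> ?N"
      unfolding coinvariant_rels_def by (rule generate.incl)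
    then show ?thesis
      using diff_in_tensor_free[OF gp p] by (simp add: R_def flag_action_reverse_chain)
  qed
  obtain v0 :: 'v where v0: "v0 \<noteq> 0" using assms(2) by blast
  obtain m where m: "\<And>x y. x \<in> St UNIV \<Longrightarrow> y \<in> St UNIV \<Longrightarrow> ?b x y - frag_cmul (flag_pairing x y) m \<in> R"
    using invariant_form_is_multiple_of_pairing[OF R bi v0 inv] by blast
  have multiple: "c - frag_cmul (frag_eval (\<lambda>(x, y). flag_pairing x y) c) m \<in> R"
    if "c \<in> carrier ?T" for c
  proof -
    have "Poly_Mapping.keys c \<subseteq> carrier ?S \<times> carrier ?S"
      using that by (simp add: tensor_free_def)
    then show ?thesis
    proof (induction c rule: frag_induction)
      case zero
      then show ?case using add_subgroup_zero[OF R] by simp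
    next
      case (one p)
      then obtain x y where p: "p = (x, y)" "x \<in> carrier ?S" "y \<in> carrier ?S" by auto
      show ?case
        using m[of "reverse_chain x" "reverse_chain y"] p in_St
        by (simp add: flag_pairing_reverse_chain)
    next
      case (diff c d)
      from add_subgroup_diff[OF R this] show ?case
        by (simp add: frag_eval_diff frag_cmul_diff_distrib algebra_simps del: minus_frag_cmul)
    qed
  qed
  have "?N = kernel ?A integer_group ?h"
  proof
    have "?gens \<subseteq> kernel ?A integer_group ?h"
    proof
      fix s assume "s \<in> ?gens"
      then obtain g a where s: "s = diagonal_action scale g a \<otimes>\<^bsub>?A\<^esub> inv\<^bsub>?A\<^esub> a"
        and ga: "g \<in> GL scale" "a \<in> carrier ?A" by blast
      note d = diagonal_action_closed_invariant[OF ga]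
      show "s \<in> kernel ?A integer_group ?h"
        using d ga by (simp add: s kernel_def)
    qed
    then show "?N \<subseteq> kernel ?A integer_group ?h"
      unfolding coinvariant_rels_def by (intro A.generate_subgroup_incl h.subgroup_kernel)
    show "kernel ?A integer_group ?h \<subseteq> ?N"
    proof
      fix a assume "a \<in> kernel ?A integer_group ?h"
      then have a: "a \<in> carrier ?A" "?h a = 0" by (auto simp: kernel_def)
      obtain c where c: "c \<in> carrier ?T" "a = ?\<pi> c"
        using a(1) unfolding steinberg_tensor_def by (rule tensor_product_cases)
      then have "c \<in> R" using multiple[OF c(1)] a(2) h_\<pi>[OF c(1)] by simp
      then show "a \<in> ?N" using c by (simp add: R_def)
    qed
  qed
  moreover have "?h ` carrier ?A = carrier integer_group"
  proof -
    obtain x y where xy: "x \<in> St UNIV" "y \<in> St UNIV" "flag_pairing x y = 1"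
      using exists_pairing_one[OF subspace_UNIV UNIV_I v0] by metis
    have "k \<in> ?h ` carrier ?A" for k
    proof
      let ?c = "frag_cmul k (?b x y)"
      have c: "?c \<in> carrier ?T"
        using rc xy keys_cmul[of k "?b x y"] by (auto simp: tensor_free_def)
      show "?\<pi> ?c \<in> carrier ?A" by (rule \<pi>_carrier[OF c])
      show "k = ?h (?\<pi> ?c)"
        using xy(3) by (simp add: h_\<pi>[OF c] frag_eval_cmul_of flag_pairing_reverse_chain)
    qed
    then show ?thesis by auto
  qed
  ultimately show ?thesis
    using h.FactGroup_iso_set unfolding coinvariants_def coinvariants_lift_def by simp
qed

end
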